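(* Let $k\ge 5$ and let $\mathcal{C}$ be a $k$-dense family of cycles. Then for every $n$, \[\mathrm{sat}_g(n,\mathcal{C})\leq \tfrac{1}{2}(k-1)(n-1)+1.\]
   Context: $C_\ell$ denotes the cycle of length $\ell$. For $k\geq 5$, a family of cycles $\mathcal{C}$ is $k$-dense if: (1) $C_k,C_{k+1}\in\mathcal{C}$, except that when $k=5$ only $C_5\in\mathcal{C}$ is required; (2) $C_\ell\notin\mathcal{C}$ for all $\ell<k$; (3) for every $s\geq 3$ there exists $\ell$ with $s+2\leq \ell\leq 3+(k-2)(s-2)$ and $C_\ell\in\mathcal{C}$. For a family of graphs $\mathcal{F}$, the $\mathcal{F}$-saturation game on $n$ vertices is played by two players, Max and Mini. Starting with Max, they alternately add edges to an initially empty graph on $n$ vertices, subject only to the constraint that no player may add an edge creating a subgraph isomorphic to a member of $\mathcal{F}$. The game ends when the graph is $\mathcal{F}$-saturated (contains no member of $\mathcal{F}$, but adding any edge creates one). Max wants the final graph to have as many edges as possible, Mini as few as possible. $\mathrm{sat}_g(n,\mathcal{F})$ denotes the number of edges in the final graph when both play optimally. *)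

theory Defs
  imports Complex_Main
begin

text \<open>A graph is a pair (vertex set, edge set), an edge being a two-element set of vertices.\<close>

type_synonym graph = "nat set \<times> nat set set"

abbreviation verts :: "graph \<Rightarrow> nat set" where "verts \<equiv> fst"
abbreviation edges :: "graph \<Rightarrow> nat set set" where "edges \<equiv> snd"

definition all_edges :: "nat set \<Rightarrow> nat set set" where
  "all_edges V = {e. e \<subseteq> V \<and> card e = 2}"

definition graph_iso :: "graph \<Rightarrow> graph \<Rightarrow> bool" where
  "graph_iso H H' \<longleftrightarrow>
     (\<exists>f. bij_betw f (verts H) (verts H') \<and> edges H' = (\<lambda>e. f ` e) ` edges H)"

definition subgraph :: "graph \<Rightarrow> graph \<Rightarrow> bool" where
  "subgraph H G \<longleftrightarrow>
     verts H \<subseteq> verts G \<and> edges H \<subseteq> edges G \<and> edges H \<subseteq> all_edges (verts H)"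

definition free_of :: "graph set \<Rightarrow> graph \<Rightarrow> bool" where
  "free_of F G \<longleftrightarrow> \<not> (\<exists>H\<in>F. \<exists>H'. subgraph H' G \<and> graph_iso H H')"

text \<open>The cycle of length \<open>l\<close>; meaningful only for \<open>l \<ge> 3\<close>.\<close>

definition cycle_graph :: "nat \<Rightarrow> graph" where
  "cycle_graph l = ({..<l}, {{i, Suc i mod l} |i. i < l})"

text \<open>Each isomorphism class of cycles is represented by its standard copy, so that
  the family contains the cycle of length \<open>l\<close> iff \<open>cycle_graph l\<close> is an element of it.\<close>

definition cycle_family :: "graph set \<Rightarrow> bool" where
  "cycle_family C \<longleftrightarrow> C \<subseteq> cycle_graph ` {3..}"

definition dense_family :: "nat \<Rightarrow> graph set \<Rightarrow> bool" where
  "dense_family k C \<longleftrightarrow>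
     cycle_family C \<and>
     cycle_graph k \<in> C \<and> (k \<noteq> 5 \<longrightarrow> cycle_graph (k + 1) \<in> C) \<and>
     (\<forall>l<k. cycle_graph l \<notin> C) \<and>
     (\<forall>s\<ge>3. \<exists>l. s + 2 \<le> l \<and> l \<le> 3 + (k - 2) * (s - 2) \<and> cycle_graph l \<in> C)"

text \<open>A position of the saturation game is the edge set \<open>E\<close> of a graph on the vertex set
  \<open>{..<n}\<close>. A position free of \<open>F\<close> is \<open>F\<close>-saturated iff it has no legal moves; since
  legal moves preserve freeness, the game ends exactly when there are none.\<close>

definition legal_moves :: "graph set \<Rightarrow> nat \<Rightarrow> nat set set \<Rightarrow> nat set set" where
  "legal_moves F n E = {e \<in> all_edges {..<n} - E. free_of F ({..<n}, insert e E)}"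

datatype player = Maxi | Mini

text \<open>The final number of edges under optimal play from position \<open>E\<close> with player \<open>p\<close> to move.\<close>

function game_value :: "graph set \<Rightarrow> nat \<Rightarrow> player \<Rightarrow> nat set set \<Rightarrow> nat" where
  "game_value F n p E =
     (if legal_moves F n E = {} then card E
      else case p of
        Maxi \<Rightarrow> Max ((\<lambda>e. game_value F n Mini (insert e E)) ` legal_moves F n E)
      | Mini \<Rightarrow> Min ((\<lambda>e. game_value F n Maxi (insert e E)) ` legal_moves F n E))"
  by pat_completeness auto

lemma finite_all_edges: "finite V \<Longrightarrow> finite (all_edges V)"
  unfolding all_edges_def by (rule finite_subset[of _ "Pow V"]) auto

lemma legal_move_decreases:
  assumes "e \<in> legal_moves F n E"
  shows "card (all_edges {..<n} - insert e E) < card (all_edges {..<n} - E)"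
  using assms by (intro psubset_card_mono finite_Diff finite_all_edges)
    (auto simp: legal_moves_def)

termination
  by (relation "measure (\<lambda>(F, n, p, E). card (all_edges {..<n} - E))")
    (auto dest: legal_move_decreases)

declare game_value.simps [simp del]

definition sat_game :: "nat \<Rightarrow> graph set \<Rightarrow> nat" where
  "sat_game n F = game_value F n Maxi {}"

end

theory Submission
  imports Defs
begin

text \<open>
  Mini keeps every block of the graph dominated by its vertex \<open>w\<close> closest to a fixed root. As the cycle of
  length \<open>k\<close> is forbidden, the block minus \<open>w\<close> then contains no path on \<open>k - 1\<close> vertices, so the Erdos-Gallai
  theorem gives at most \<open>(k - 1) / 2\<close> edges per non-root vertex. The additional \<open>1\<close> accounts for a last move of Max.

  Mini cannot afford domination everywhere: each component of the children of the root may contain one vertex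
  that is not adjacent to the root. A vertex \<open>a\<close> is a cut vertex with further blocks below it only if it is full,
  that is, joined to the root of its block by a path of length \<open>k - 2\<close> through vertices dominated by that root.
  Walking through full vertices, a path realises all lengths of a long interval, and condition (3) of density
  says exactly that some length in the interval is forbidden. Hence Max can only add edges inside a block, between
  two blocks with the same root, or to new vertices, and Mini can repair the structure after each such move.
\<close>

section \<open>Simple paths and cycles\<close>


text \<open>A vertex in \<open>D\<close> is a debt. When Max joins two isolated vertices, a single
  reply links only one of them to the root, so the new component of children of the root starts with
  a debt. Its root edge pays it, a move that never disturbs the structure and that also serves Mini
  when nothing needs repair. The obstacle is a sibling edge merging two components that both carry a
  debt: two debts, one reply. A path of k - 1 siblings whose ends both see the parent closes a cycle
  of length k, so after a legal move every such path ends in a debt. If one exists, rerouting it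
  shows that a suitable debt is pendant at a full vertex; declaring that vertex its parent clears
  the debt without a move. Some reroutings lengthen the path by one vertex, and this is where the
  cycle of length k + 1 enters. For k = 5 that cycle need not be forbidden, and the invariant
  demands instead that each vertex of \<open>D\<close> have exactly one neighbour.\<close>

definition simple_path :: "('a \<Rightarrow> 'a \<Rightarrow> bool) \<Rightarrow> 'a list \<Rightarrow> bool" where
  "simple_path R xs \<longleftrightarrow> distinct xs \<and> successively R xs"

definition cyc :: "'a set set \<Rightarrow> 'a list \<Rightarrow> bool" where
  "cyc E xs \<longleftrightarrow> simple_path (\<lambda>a b. {a, b} \<in> E) xs \<and> 3 \<le> length xs \<and> {last xs, hd xs} \<in> E"

lemma successively_iff: "successively R (us @ vs) \<longleftrightarrow>
    successively R us \<and> successively R vs \<and> (us = [] \<or> vs = [] \<or> R (last us) (hd vs))"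
  by (auto simp: successively_append_iff)

lemma simple_path_append:
  "simple_path R (us @ vs) \<longleftrightarrow> simple_path R us \<and> simple_path R vs \<and> set us \<inter> set vs = {}
     \<and> (us = [] \<or> vs = [] \<or> R (last us) (hd vs))"
  by (auto simp: simple_path_def successively_iff)

lemma simple_path_Cons:
  "simple_path R (x # xs) \<longleftrightarrow> x \<notin> set xs \<and> simple_path R xs \<and> (xs = [] \<or> R x (hd xs))"
  by (auto simp: simple_path_def successively_Cons)

lemma simple_path_Nil [simp]: "simple_path R []"
  by (auto simp: simple_path_def)

lemma simple_path_rev:
  assumes "\<And>a b. R a b \<Longrightarrow> R b a"
  shows "simple_path R (rev xs) \<longleftrightarrow> simple_path R xs"
proof -
  have "(\<lambda>x y. R y x) = R" using assms by blast
  then show ?thesis unfolding simple_path_def successively_rev distinct_rev by (simp only:)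
qed

lemma simple_path_mono:
  assumes "simple_path R xs" "\<And>a b. a \<in> set xs \<Longrightarrow> b \<in> set xs \<Longrightarrow> R a b \<Longrightarrow> R' a b"
  shows "simple_path R' xs"
  using assms(1) successively_mono[of R xs R'] assms(2) unfolding simple_path_def by blast

text \<open>The propagation tool: \<open>P\<close> is later the parent map, a component label, or
  membership in a block, each of which is preserved along single edges of a path.\<close>

lemma successively_invariant:
  assumes "successively R xs" "\<And>a b. a \<in> set xs \<Longrightarrow> b \<in> set xs \<Longrightarrow> R a b \<Longrightarrow> P a = P b" "a \<in> set xs" "b \<in> set xs"
  shows "P a = P b"
proof -
  have "\<forall>a\<in>set xs. P a = P (hd xs)"
    using assms(1,2)
  proof (induction xs)
    case (Cons x xs)
    have IH: "\<forall>a\<in>set xs. P a = P (hd xs)"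
    proof (rule Cons.IH)
      show "successively R xs" using Cons.prems(1) by (auto simp: successively_Cons)
      show "P a = P b" if "a \<in> set xs" "b \<in> set xs" "R a b" for a b
        using Cons.prems(2)[of a b] that by simp
    qed
    show ?case
    proof (cases "xs = []")
      case False
      then have "P x = P (hd xs)"
        using Cons.prems(2)[of x "hd xs"] Cons.prems(1) by (simp add: successively_Cons)
      then show ?thesis using IH by simp
    qed simp
  qed simp
  then show ?thesis using assms(3,4) by metis
qed

lemma simple_path_nth:
  assumes "simple_path R xs" "Suc i < length xs"
  shows "R (xs ! i) (xs ! Suc i)"
  using assms by (auto simp: simple_path_def successively_conv_nth)

text \<open>Together with \<open>not_free_cyc\<close> this translates freeness, stated through
  isomorphic subgraphs, into cycles given as vertex lists. The isomorphism is indexing, i to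
  \<open>xs ! i\<close>.\<close>

lemma cyc_not_free:
  assumes "cyc E xs" "set xs \<subseteq> V" "cycle_graph (length xs) \<in> C"
  shows "\<not> free_of C (V, E)"
proof -
  define l where "l = length xs"
  have d: "distinct xs" and l3: "3 \<le> l" and clos: "{last xs, hd xs} \<in> E"
    using assms by (auto simp: cyc_def simple_path_def l_def)
  define H where "H = (set xs, {{xs ! i, xs ! (Suc i mod l)} |i. i < l})"
  have inE: "{xs ! i, xs ! (Suc i mod l)} \<in> E" if "i < l" for i
  proof (cases "Suc i = l")
    case True
    then have "Suc i mod l = 0" by simp
    moreover have "xs \<noteq> []" using l3 l_def by auto
    moreover have "i = l - 1" using True by simp
    ultimately show ?thesis using clos by (simp add: last_conv_nth hd_conv_nth l_def)
  next
    case False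
    then have "Suc i < l" using that by simp
    then show ?thesis
      using assms(1) simple_path_nth[of _ xs i] by (auto simp: cyc_def l_def)
  qed
  have ne: "xs ! i \<noteq> xs ! (Suc i mod l)" if "i < l" for i
  proof -
    have "i \<noteq> Suc i mod l"
      using that l3 by (cases "Suc i = l") auto
    then show ?thesis using that l3 nth_eq_iff_index_eq[OF d, of i "Suc i mod l"] mod_less_divisor[of l "Suc i"]
      by (metis l_def less_le_trans zero_less_numeral)
  qed
  have "xs ! (Suc i mod l) \<in> set xs" for i
    using l3 l_def mod_less_divisor[of l "Suc i"] by (intro nth_mem) linarith
  then have "subgraph H (V, E)"
    unfolding subgraph_def H_def all_edges_def using assms(2) inE ne l3
    by (auto simp: l_def card_insert_if)
  moreover have "graph_iso (cycle_graph l) H"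
    unfolding graph_iso_def
  proof (intro exI[of _ "nth xs"] conjI)
    show "bij_betw ((!) xs) (verts (cycle_graph l)) (verts H)"
      unfolding cycle_graph_def H_def using bij_betw_nth[OF d] by (simp add: l_def)
    have "{{xs ! i, xs ! (Suc i mod l)} |i. i < l} = (\<lambda>i. {xs ! i, xs ! (Suc i mod l)}) ` {..<l}" by auto
    moreover have "{{i, Suc i mod l} |i. i < l} = (\<lambda>i. {i, Suc i mod l}) ` {..<l}" by auto
    ultimately show "edges H = (\<lambda>e. (!) xs ` e) ` edges (cycle_graph l)"
      unfolding cycle_graph_def H_def by (simp only: snd_conv image_image image_insert image_empty)
  qed
  ultimately show ?thesis using assms(3) unfolding free_of_def l_def by blast
qed

lemma not_free_cyc:
  assumes "cycle_family C" "\<not> free_of C (V, E)"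
  obtains xs where "cyc E xs" "cycle_graph (length xs) \<in> C"
proof -
  obtain H H' where H: "H \<in> C" "subgraph H' (V, E)" "graph_iso H H'"
    using assms by (auto simp: free_of_def)
  obtain l where l: "3 \<le> l" "H = cycle_graph l" using H(1) assms(1) by (auto simp: cycle_family_def)
  obtain f where f: "bij_betw f {..<l} (verts H')" "edges H' = (\<lambda>e. f ` e) ` {{i, Suc i mod l} |i. i < l}"
    using H(3) l(2) by (auto simp: graph_iso_def cycle_graph_def)
  have inE: "{f i, f (Suc i mod l)} \<in> E" if "i < l" for i
  proof -
    have "{f i, f (Suc i mod l)} \<in> edges H'"
      unfolding f(2) using that by (intro image_eqI[of _ _ "{i, Suc i mod l}"]) auto
    then show ?thesis using H(2) by (auto simp: subgraph_def)
  qed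
  let ?xs = "map f [0..<l]"
  have "distinct ?xs" using f(1) by (auto simp: distinct_map bij_betw_def atLeast0LessThan)
  moreover have "successively (\<lambda>a b. {a, b} \<in> E) ?xs"
    unfolding successively_conv_nth
  proof (intro allI impI)
    fix i assume "Suc i < length ?xs"
    then show "{?xs ! i, ?xs ! Suc i} \<in> E" using inE[of i] by simp
  qed
  moreover have "{last ?xs, hd ?xs} \<in> E"
    using inE[of "l - 1"] l(1) by (auto simp: last_map last_upt hd_map)
  ultimately have "cyc E ?xs" using l(1) by (auto simp: cyc_def simple_path_def)
  then show ?thesis using that[of ?xs] H(1) l(2) by simp
qed

section \<open>The Erdos-Gallai theorem for paths\<close>


text \<open>A closed path can be opened at any of its vertices. The closing edge is demanded only
  for non-empty \<open>us\<close>; otherwise \<open>c\<close> already stands first.\<close>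

lemma closed_path_rotate:
  assumes "simple_path R (us @ c # vs)" "us \<noteq> [] \<Longrightarrow> R (last (c # vs)) (hd us)"
  shows "simple_path R (c # vs @ us)"
  using assms by (cases "us = []") (auto simp: simple_path_append simple_path_Cons split: if_splits)

text \<open>The crossing argument of Ore and Posa. All neighbours of the two ends lie on a longest
  path; if the end degrees add up to its number of vertices, two chords cross and turn it into a
  cycle on the same vertices. An edge leaving this cycle would yield a longer path.\<close>

lemma longest_path_closed:
  fixes S :: "nat set set"
  defines "R \<equiv> \<lambda>a b. {a, b} \<in> S"
  assumes S: "\<And>a. {a} \<notin> S"
    and p: "simple_path R xs" "length xs \<ge> 1"
    and mx: "\<And>ys. simple_path R ys \<Longrightarrow> length ys \<le> length xs"
    and deg: "card {u. R (hd xs) u} + card {u. R (last xs) u} \<ge> length xs"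
    and z: "c \<in> set xs" "R c z"
  shows "z \<in> set xs"
proof -
  let ?p = "length xs"
  have sym: "R a b \<Longrightarrow> R b a" for a b by (auto simp: R_def insert_commute)
  have rev: "simple_path R (rev zs) = simple_path R zs" for zs by (rule simple_path_rev) (rule sym)
  have d: "distinct xs" using p by (simp add: simple_path_def)
  have ne: "xs \<noteq> []" using p by auto
  have irr: "\<not> R a a" for a using S by (auto simp: R_def)
  have N1: "u \<in> set xs" if "R (hd xs) u" for u
  proof (rule ccontr)
    assume "u \<notin> set xs"
    then have "simple_path R (u # xs)" using p sym[OF that] by (simp add: simple_path_Cons)
    then show False using mx[of "u # xs"] by simp
  qed
  have N2: "u \<in> set xs" if "R (last xs) u" for u
  proof (rule ccontr)
    assume "u \<notin> set xs"
    then have "simple_path R (xs @ [u])" using p that by (simp add: simple_path_append simple_path_Cons)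
    then show False using mx[of "xs @ [u]"] by simp
  qed
  \<comment> \<open>Both sets index edges of the path: those whose later vertex is adjacent to the
    head, and those whose earlier vertex is adjacent to the last vertex. There are only
    \<open>?p - 1\<close> indices, while the sizes add up to at least \<open>?p\<close>, so the sets
    meet.\<close>
  let ?I = "{i. Suc i < ?p \<and> R (hd xs) (xs ! Suc i)}"
  let ?J = "{i. Suc i < ?p \<and> R (last xs) (xs ! i)}"
  have "{u. R (hd xs) u} = (\<lambda>i. xs ! Suc i) ` ?I"
  proof (intro set_eqI iffI)
    fix u assume "u \<in> {u. R (hd xs) u}"
    then have u: "R (hd xs) u" by simp
    obtain j where j: "j < ?p" "u = xs ! j" using N1[OF u] by (metis in_set_conv_nth)
    have "j \<noteq> 0" using u j(2) irr[of "hd xs"] ne by (metis hd_conv_nth)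
    then show "u \<in> (\<lambda>i. xs ! Suc i) ` ?I" using u j by (intro image_eqI[of _ _ "j - 1"]) auto
  qed auto
  moreover have fin: "finite ?I" "finite ?J" by (auto intro: finite_subset[of _ "{..<?p}"])
  ultimately have cI: "card {u. R (hd xs) u} \<le> card ?I" by (metis (lifting) card_image_le)
  have "{u. R (last xs) u} = (\<lambda>i. xs ! i) ` ?J"
  proof (intro set_eqI iffI)
    fix u assume "u \<in> {u. R (last xs) u}"
    then have u: "R (last xs) u" by simp
    obtain j where j: "j < ?p" "u = xs ! j" using N2[OF u] by (metis in_set_conv_nth)
    have "j \<noteq> ?p - 1" using u j(2) irr[of "last xs"] ne by (metis last_conv_nth)
    then show "u \<in> (\<lambda>i. xs ! i) ` ?J" using u j by (intro image_eqI[of _ _ j]) auto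
  qed auto
  then have cJ: "card {u. R (last xs) u} \<le> card ?J" using fin by (metis (lifting) card_image_le)
  have "?I \<inter> ?J \<noteq> {}"
  proof
    assume e: "?I \<inter> ?J = {}"
    have "card (?I \<union> ?J) \<le> card {..<?p - 1}" by (intro card_mono) auto
    then have "card ?I + card ?J \<le> ?p - 1" using e fin by (simp add: card_Un_disjoint)
    then show False using cI cJ deg p(2) by linarith
  qed
  then obtain i where i: "Suc i < ?p" "R (hd xs) (xs ! Suc i)" "R (last xs) (xs ! i)" by auto
  let ?A = "take (Suc i) xs" and ?B = "drop (Suc i) xs"
  have AB: "?A \<noteq> []" "?B \<noteq> []" using i ne by auto
  have pp: "simple_path R (?A @ ?B)" using p by simp
  have lastA: "last ?A = xs ! i" using i(1) ne by (simp add: take_Suc_conv_app_nth)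
  have lastB: "last ?B = last xs" using i by simp
  have hdB: "hd ?B = xs ! Suc i" using i by (simp add: hd_drop_conv_nth)
  \<comment> \<open>Reversing the second half makes the chord from \<open>xs ! i\<close> to the last
    vertex a path edge, and the chord from the head to \<open>xs ! Suc i\<close> becomes the closing
    edge.\<close>
  let ?ys = "?A @ rev ?B"
  have ys: "simple_path R ?ys"
    using pp AB sym[OF i(3)] sym[OF sym[OF i(3)]] unfolding simple_path_append[of R ?A]
    by (simp add: rev lastA hd_rev lastB)
  have hl: "R (last ?ys) (hd ?ys)"
    using AB sym[OF i(2)] ne by (simp add: last_rev hdB hd_append)
  have sy: "set ?ys = set xs" using set_append[of ?A ?B] by simp
  show ?thesis
  proof (rule ccontr)
    assume zn: "z \<notin> set xs"
    obtain us vs where uv: "?ys = us @ c # vs" using z(1) sy by (metis split_list)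
    have "simple_path R (c # vs @ us)"
    proof (rule closed_path_rotate)
      show "simple_path R (us @ c # vs)" using ys uv by simp
      show "R (last (c # vs)) (hd us)" if "us \<noteq> []" using hl that unfolding uv by (simp add: hd_append)
    qed
    moreover have s: "set (c # vs @ us) = set xs" using sy unfolding uv by auto
    ultimately have "simple_path R (z # c # vs @ us)"
      using zn sym[OF z(2)] by (subst simple_path_Cons) auto
    moreover have "length (c # vs @ us) = ?p" using arg_cong[OF uv, of length] i by simp
    ultimately show False using mx[of "z # c # vs @ us"] by simp
  qed
qed

text \<open>Induction on the number of vertices. A vertex of degree at most (t - 2) / 2 is deleted.
  If there is none, the end degrees of a longest path add up to at least t - 1, hence to its number
  p < t of vertices, so no edge leaves the path. Its vertex set is then deleted; even a complete
  graph on it has only p (p - 1) / 2 edges.\<close>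

theorem erdos_gallai_path:
  fixes S :: "nat set set"
  assumes "finite V" "S \<subseteq> all_edges V" "2 \<le> t"
    and "\<And>xs. simple_path (\<lambda>a b. {a, b} \<in> S) xs \<Longrightarrow> length xs < t"
  shows "2 * card S \<le> (t - 2) * card V"
  using assms(1,2,4)
proof (induction "card V" arbitrary: V S rule: less_induct)
  case less
  let ?R = "\<lambda>a b. {a, b} \<in> S"
  have finS: "finite S" using less.prems(1,2) finite_all_edges finite_subset by blast
  have S1: "{a} \<notin> S" for a using less.prems(2) by (auto simp: all_edges_def)
  have SV: "a \<in> V \<and> b \<in> V" if "{a, b} \<in> S" for a b using less.prems(2) that by (auto simp: all_edges_def)
  have S2: "\<exists>a b. e = {a, b} \<and> a \<noteq> b" if "e \<in> S" for e
    using less.prems(2) that by (auto simp: all_edges_def card_2_iff)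
  have shorter: "length xs < t" if "simple_path (\<lambda>a b. {a, b} \<in> S') xs" "S' \<subseteq> S" for S' xs
    using that by (intro less.prems(3) simple_path_mono[OF that(1)]) auto
  show ?case
  proof (cases "\<exists>v\<in>V. 2 * card {u. ?R v u} \<le> t - 2")
    case True
    then obtain v where v: "v \<in> V" "2 * card {u. ?R v u} \<le> t - 2" by auto
    let ?S' = "{e \<in> S. v \<notin> e}"
    have Seq: "S = ?S' \<union> (\<lambda>u. {v, u}) ` {u. ?R v u}"
    proof (intro set_eqI iffI)
      fix e assume e: "e \<in> S"
      show "e \<in> ?S' \<union> (\<lambda>u. {v, u}) ` {u. ?R v u}"
      proof (cases "v \<in> e")
        case True
        then obtain u where "e = {v, u}" using S2[OF e] by blast
        then show ?thesis using e by blast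
      qed (use e in blast)
    qed blast
    have finN: "finite {u. ?R v u}"
      by (rule finite_subset[OF _ less.prems(1)]) (use SV in auto)
    have "card S \<le> card ?S' + card {u. ?R v u}"
      using arg_cong[OF Seq, of card] card_Un_le[of ?S' "(\<lambda>u. {v, u}) ` {u. ?R v u}"] card_image_le[OF finN, of "\<lambda>u. {v, u}"]
      by linarith
    moreover have "2 * card ?S' \<le> (t - 2) * card (V - {v})"
    proof (rule less.hyps)
      show "card (V - {v}) < card V" using v less.prems(1) by (metis card_Diff1_less)
      show "?S' \<subseteq> all_edges (V - {v})" using less.prems(2) by (auto simp: all_edges_def)
      show "length xs < t" if "simple_path (\<lambda>a b. {a, b} \<in> ?S') xs" for xs
        using shorter[OF that] by auto
    qed (use less.prems in auto)
    moreover have "card V = Suc (card (V - {v}))"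
      using v less.prems(1) by (metis card.remove)
    ultimately show ?thesis using v(2) by simp
  next
    case False
    show ?thesis
    proof (cases "V = {}")
      case True
      then have "S = {}" using less.prems(2) by (auto simp: all_edges_def)
      then show ?thesis by simp
    next
      case nonempty: False
      then obtain v0 where v0: "v0 \<in> V" by auto
      define P where "P = (\<lambda>xs. simple_path ?R xs \<and> set xs \<subseteq> V \<and> xs \<noteq> [])"
      have "P [v0]" using v0 by (simp add: P_def simple_path_Cons)
      moreover have "\<forall>xs. P xs \<longrightarrow> length xs < t" using less.prems(3) by (auto simp: P_def)
      ultimately obtain xs where xs: "P xs" and mx: "\<And>ys. P ys \<Longrightarrow> length ys \<le> length xs"
        using ex_has_greatest_nat[of P "[v0]" length t] by auto
      let ?p = "length xs"
      have ne: "xs \<noteq> []" and sp: "simple_path ?R xs" and sv: "set xs \<subseteq> V" using xs by (auto simp: P_def)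
      have p1: "1 \<le> ?p" using ne by (cases xs) auto
      \<comment> \<open>\<open>simple_path\<close> accepts a single vertex outside \<open>V\<close>,
        but every vertex of a longer path lies in an edge and hence in \<open>V\<close>. Maximality
        among paths in \<open>V\<close> is therefore maximality outright.\<close>
      have mx': "length ys \<le> ?p" if ys: "simple_path ?R ys" for ys
      proof (cases "length ys \<le> 1")
        case False
        have "set ys \<subseteq> V"
        proof
          fix y assume "y \<in> set ys"
          then obtain j where j: "j < length ys" "y = ys ! j" by (metis in_set_conv_nth)
          show "y \<in> V"
          proof (cases "Suc j < length ys")
            case True
            then show ?thesis using SV simple_path_nth[OF ys True] j by auto
          next
            case F: False
            then have "Suc (j - 1) < length ys" "Suc (j - 1) = j" using j False by auto
            then show ?thesis using SV simple_path_nth[OF ys, of "j - 1"] j by auto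
          qed
        qed
        then show ?thesis using mx[of ys] ys False by (cases "ys = []") (auto simp: P_def)
      qed (use p1 in auto)
      have d: "2 * card {u. ?R v u} \<ge> t - 1" if "v \<in> V" for v
        using False that by (auto simp: not_le)
      have deg: "card {u. ?R (hd xs) u} + card {u. ?R (last xs) u} \<ge> ?p"
        using d[of "hd xs"] d[of "last xs"] sv ne less.prems(3)[OF sp] by (auto simp: subset_iff)
      have closed: "z \<in> set xs" if "c \<in> set xs" "?R c z" for c z
        using longest_path_closed[of S xs c z, OF S1 sp p1 mx' deg that] .
      let ?X = "set xs"
      let ?S1 = "{e \<in> S. e \<subseteq> ?X}" and ?S2 = "{e \<in> S. e \<inter> ?X = {}}"
      have "S \<subseteq> ?S1 \<union> ?S2"
      proof
        fix e assume e: "e \<in> S"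
        then obtain a b where ab: "e = {a, b}" using S2 by blast
        have "?R a b" "?R b a" using e ab by (auto simp: insert_commute)
        then show "e \<in> ?S1 \<union> ?S2" using closed e ab by blast
      qed
      then have "card S \<le> card (?S1 \<union> ?S2)" using finS by (intro card_mono) auto
      also have "\<dots> \<le> card ?S1 + card ?S2" by (rule card_Un_le)
      finally have c: "card S \<le> card ?S1 + card ?S2" .
      have cX: "card ?X = ?p" using sp by (simp add: simple_path_def distinct_card)
      have "card ?S1 \<le> card {e. e \<subseteq> ?X \<and> card e = 2}"
        using less.prems(2) by (intro card_mono) (auto simp: all_edges_def intro: finite_subset[of _ "Pow ?X"])
      also have "\<dots> = ?p choose 2" using n_subsets[of ?X 2] cX by simp
      finally have "2 * card ?S1 \<le> ?p * (?p - 1)" by (simp add: choose_two)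
      also have "\<dots> \<le> ?p * (t - 2)" using less.prems(3)[OF sp] by (intro mult_le_mono) auto
      finally have c1: "2 * card ?S1 \<le> (t - 2) * card ?X" by (simp add: cX mult.commute)
      have c2: "2 * card ?S2 \<le> (t - 2) * card (V - ?X)"
      proof (rule less.hyps)
        show "card (V - ?X) < card V" 
        proof (rule psubset_card_mono)
          have "hd xs \<in> V \<inter> set xs" using sv ne by auto
          then show "V - ?X \<subset> V" by blast
        qed (use less.prems in simp)
        show "?S2 \<subseteq> all_edges (V - ?X)" using less.prems(2) by (auto simp: all_edges_def)
        show "length ys < t" if "simple_path (\<lambda>a b. {a, b} \<in> ?S2) ys" for ys
          using shorter[OF that] by auto
      qed (use less.prems in auto)
      have "card V = card ?X + card (V - ?X)"
        using sv less.prems(1) card_Diff_subset[of ?X V] card_mono[of V ?X] by simp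
      then have "(t - 2) * card V = (t - 2) * card ?X + (t - 2) * card (V - ?X)"
        by (simp add: distrib_left)
      then show ?thesis using c c1 c2 by linarith
    qed
  qed
qed

section \<open>Rooted trees of dominated blocks\<close>


lemma cyc_subset:
  assumes "cyc E xs" "\<And>e. e \<in> E \<Longrightarrow> e \<subseteq> V"
  shows "set xs \<subseteq> V"
proof
  fix a assume "a \<in> set xs"
  then obtain j where j: "j < length xs" "a = xs ! j" by (metis in_set_conv_nth)
  have sp: "simple_path (\<lambda>a b. {a, b} \<in> E) xs" and cl: "{last xs, hd xs} \<in> E" and l: "3 \<le> length xs"
    using assms(1) by (auto simp: cyc_def)
  show "a \<in> V"
  proof (cases "Suc j < length xs")
    case True
    then show ?thesis using simple_path_nth[OF sp True] j assms(2) by blast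
  next
    case False
    then have "j = length xs - 1" using j by simp
    then have "a = last xs" using j l last_conv_nth[of xs] by fastforce
    then show ?thesis using cl assms(2) by blast
  qed
qed

section \<open>Sibling paths and full vertices\<close>

definition sib :: "nat set set \<Rightarrow> nat set \<Rightarrow> (nat \<Rightarrow> nat) \<Rightarrow> nat \<Rightarrow> nat \<Rightarrow> bool" where
  "sib E W \<rho> a b \<longleftrightarrow> a \<in> W \<and> b \<in> W \<and> \<rho> a = \<rho> b \<and> {a, b} \<in> E"

text \<open>Leaving the path for the parent after l vertices gives a route from \<open>c\<close> to
  its parent with exactly l edges, for every l from 1 to k - 2. The number k - 2 is the largest that
  the bound \<open>short\<close> of the invariant permits.\<close>

definition full_path :: "nat set set \<Rightarrow> nat set \<Rightarrow> (nat \<Rightarrow> nat) \<Rightarrow> nat \<Rightarrow> nat \<Rightarrow> nat list \<Rightarrow> bool" where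
  "full_path E W \<rho> k c xs \<longleftrightarrow> simple_path (sib E W \<rho>) xs \<and> length xs = k - 2 \<and> hd xs = c
     \<and> (\<forall>a\<in>set xs. a \<in> W \<and> \<rho> a = \<rho> c \<and> {a, \<rho> c} \<in> E)"

definition full :: "nat set set \<Rightarrow> nat set \<Rightarrow> (nat \<Rightarrow> nat) \<Rightarrow> nat \<Rightarrow> nat \<Rightarrow> bool" where
  "full E W \<rho> k c \<longleftrightarrow> (\<exists>xs. full_path E W \<rho> k c xs)"

lemma sib_sym: "sib E W \<rho> a b \<Longrightarrow> sib E W \<rho> b a"
  by (auto simp: sib_def insert_commute)

lemma sib_path_rev: "simple_path (sib E W \<rho>) (rev xs) = simple_path (sib E W \<rho>) xs"
  by (rule simple_path_rev) (rule sib_sym)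

lemma sib_path_const:
  assumes "simple_path (sib E W \<rho>) xs" "a \<in> set xs" "b \<in> set xs"
  shows "\<rho> a = \<rho> b"
proof (rule successively_invariant[where P = \<rho>])
  show "successively (sib E W \<rho>) xs" using assms(1) by (simp add: simple_path_def)
qed (use assms in \<open>simp_all add: sib_def\<close>)

lemma sib_path_subset:
  assumes "simple_path (sib E W \<rho>) xs" "2 \<le> length xs"
  shows "set xs \<subseteq> W"
proof
  fix a assume a: "a \<in> set xs"
  have s: "successively (sib E W \<rho>) xs" using assms(1) by (simp add: simple_path_def)
  have "sib E W \<rho> (xs ! 0) (xs ! 1)" using simple_path_nth[OF assms(1), of 0] assms(2) by simp
  then have x: "xs ! 0 \<in> W" by (simp add: sib_def)
  have "xs ! 0 \<in> set xs" using assms(2) by (intro nth_mem) linarith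
  then have "(a \<in> W) = (xs ! 0 \<in> W)"
    by (intro successively_invariant[OF s _ a, where P = "\<lambda>a. a \<in> W"]) (simp_all add: sib_def)
  then show "a \<in> W" using x by simp
qed

text \<open>Mini keeps the non-isolated vertices in a rooted tree of blocks: \<open>W\<close> is the set of non-root vertices,
  the parent \<open>\<rho> a\<close> of \<open>a\<close> is the cut vertex through which the block of \<open>a\<close> hangs, and \<open>h\<close> is the depth.
  Parents are adjacent to their children, except that the root may miss the vertices in \<open>D\<close>.
  Only full vertices and the root have children.\<close>

locale forest =
  fixes k n r :: nat and E :: "nat set set" and W :: "nat set" and \<rho> h :: "nat \<Rightarrow> nat" and D :: "nat set"
  assumes k5: "5 \<le> k"
    and W: "W \<subseteq> {..<n} - {r}" and r: "r < n"
    and edge: "\<And>e. e \<in> E \<Longrightarrow> \<exists>a b. e = {a, b} \<and> a \<in> W \<and> (b = \<rho> a \<or> b \<in> W \<and> \<rho> b = \<rho> a \<and> a \<noteq> b)"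
    and parent: "\<And>a. a \<in> W \<Longrightarrow> \<rho> a \<in> insert r W"
    and depth_root: "h r = 0" and depth: "\<And>a. a \<in> W \<Longrightarrow> h a = Suc (h (\<rho> a))"
    and D: "D \<subseteq> W" and D_parent: "\<And>d. d \<in> D \<Longrightarrow> \<rho> d = r" and D_nonadj: "\<And>d. d \<in> D \<Longrightarrow> {d, r} \<notin> E"
    and D_nbr: "\<And>d. d \<in> D \<Longrightarrow> \<exists>b\<in>W. {d, b} \<in> E"
    and up: "\<And>a. a \<in> W \<Longrightarrow> a \<notin> D \<Longrightarrow> {a, \<rho> a} \<in> E"
    and parent_full: "\<And>a. a \<in> W \<Longrightarrow> \<rho> a \<in> W \<Longrightarrow> full E W \<rho> k (\<rho> a)"

text \<open>The labels \<open>\<kappa>\<close> are constant on the components formed by children of the root,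
  so each of these components contains at most one vertex of \<open>D\<close>.\<close>

locale good = forest +
  fixes \<kappa> :: "nat \<Rightarrow> nat"
  assumes short: "\<And>xs. simple_path (sib E W \<rho>) xs \<Longrightarrow> length xs < k - 1"
    and label: "\<And>a b. sib E W \<rho> a b \<Longrightarrow> \<rho> a = r \<Longrightarrow> \<kappa> a = \<kappa> b"
    and label_inj: "inj_on \<kappa> D"
    and five: "\<And>d b b'. k = 5 \<Longrightarrow> d \<in> D \<Longrightarrow> {d, b} \<in> E \<Longrightarrow> {d, b'} \<in> E \<Longrightarrow> b = b'"

context forest
begin

lemma rW: "r \<notin> W" using W by auto

lemma parent_neq: "a \<in> W \<Longrightarrow> \<rho> a \<noteq> a"
  using depth[of a] by (metis n_not_Suc_n)

lemma related:
  assumes "{a, b} \<in> E"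
  shows "a \<in> W \<and> \<rho> a = b \<or> b \<in> W \<and> \<rho> b = a \<or> sib E W \<rho> a b"
proof -
  obtain a' b' where e: "{a, b} = {a', b'}" "a' \<in> W" "b' = \<rho> a' \<or> b' \<in> W \<and> \<rho> b' = \<rho> a' \<and> a' \<noteq> b'"
    using edge[OF assms] by blast
  then have "a = a' \<and> b = b' \<or> a = b' \<and> b = a'" by (auto simp: doubleton_eq_iff)
  then show ?thesis
  proof
    assume "a = a' \<and> b = b'"
    then show ?thesis using e(2,3) assms unfolding sib_def by metis
  next
    assume "a = b' \<and> b = a'"
    then show ?thesis using e(2,3) assms unfolding sib_def by metis
  qed
qed

lemma edge_vertices: "{a, b} \<in> E \<Longrightarrow> a \<in> insert r W \<and> b \<in> insert r W"
  using related[of a b] parent by (auto simp: sib_def)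

lemma edge_neq: "{a, b} \<in> E \<Longrightarrow> a \<noteq> b"
proof
  assume "{a, b} \<in> E" "a = b"
  then have "{a} \<in> E" by simp
  then obtain x y where xy: "{a} = {x, y}" "x \<in> W" "y = \<rho> x \<or> x \<noteq> y" using edge by blast
  then have "x = y" by auto
  then show False using xy parent_neq[of x] by simp
qed

lemma edges_subset: "E \<subseteq> all_edges {..<n}"
proof
  fix e assume e: "e \<in> E"
  obtain a b where ab: "e = {a, b}" using edge[OF e] by blast
  then have "a \<in> insert r W \<and> b \<in> insert r W" "a \<noteq> b" using e edge_vertices edge_neq by auto
  then show "e \<in> all_edges {..<n}" using ab W r by (auto simp: all_edges_def)
qed

end

context good
begin

text \<open>Let z be a deepest vertex of the cycle and w its parent. Away from w the cycle cannot
  leave the children of w: upwards it would have to pass w, downwards it would exceed the depth of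
  z. So the cycle without w is a sibling path, to which \<open>short\<close> applies.\<close>

lemma cyc_short:
  assumes "cyc E xs"
  shows "length xs < k"
proof -
  have sp: "simple_path (\<lambda>a b. {a, b} \<in> E) xs" and l: "3 \<le> length xs" and cl: "{last xs, hd xs} \<in> E"
    using assms by (auto simp: cyc_def)
  have ne: "xs \<noteq> []" using l by auto
  have sV: "set xs \<subseteq> insert r W"
  proof (rule cyc_subset[OF assms])
    fix e assume "e \<in> E"
    from edge[OF this] show "e \<subseteq> insert r W" using parent by auto
  qed
  define M where "M = Max (h ` set xs)"
  have "M \<in> h ` set xs" unfolding M_def using ne by (intro Max_in) auto
  then obtain z where z: "z \<in> set xs" "h z = M" by auto
  have zmax: "h a \<le> h z" if "a \<in> set xs" for a using that z unfolding M_def by simp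
  have zW: "z \<in> W"
  proof (rule ccontr)
    assume "z \<notin> W"
    then have "h z = 0" using sV z depth_root by auto
    then have "a = r" if "a \<in> set xs" for a using zmax[OF that] sV that depth[of a] by auto
    then have "set xs \<subseteq> {r}" by blast
    then have "card (set xs) \<le> 1" using card_mono[of "{r}" "set xs"] by simp
    then show False using sp l by (simp add: simple_path_def distinct_card)
  qed
  define w where "w = \<rho> z"
  have sub: "length ys < k - 1"
    if ys: "simple_path (\<lambda>a b. {a, b} \<in> E) ys" "set ys \<subseteq> set xs" "w \<notin> set ys" "z \<in> set ys" for ys
  proof -
    have *: "a \<in> W \<and> \<rho> a = w" if a: "a \<in> set ys" for a
    proof -
      have "(a \<in> W \<and> \<rho> a = w) = (z \<in> W \<and> \<rho> z = w)"
      proof (rule successively_invariant[where xs = ys and P = "\<lambda>a. a \<in> W \<and> \<rho> a = w"])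
        show "successively (\<lambda>a b. {a, b} \<in> E) ys" using ys(1) by (simp add: simple_path_def)
        fix a b assume ab: "a \<in> set ys" "b \<in> set ys" "{a, b} \<in> E"
        have no: False if "x \<in> set ys" "y \<in> set ys" "x \<in> W" "\<rho> x = y" "y \<in> W" "\<rho> y = w" for x y
          using depth[of x] depth[of y] depth[of z] zW zmax[of x] ys(2) that by (auto simp: w_def)
        show "(a \<in> W \<and> \<rho> a = w) = (b \<in> W \<and> \<rho> b = w)"
          using related[OF ab(3)] no[of a b] no[of b a] ab ys(3) by (auto simp: sib_def)
      qed (use a ys in auto)
      then show ?thesis using zW by (simp add: w_def)
    qed
    have "simple_path (sib E W \<rho>) ys"
      by (rule simple_path_mono[OF ys(1)]) (use * in \<open>auto simp: sib_def\<close>)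
    then show ?thesis by (rule short)
  qed
  show ?thesis
  proof (cases "w \<in> set xs")
    case False
    then show ?thesis using sub[of xs] sp z(1) by simp
  next
    case True
    then obtain us vs where uv: "xs = us @ w # vs" by (metis split_list)
    have "simple_path (\<lambda>a b. {a, b} \<in> E) (w # vs @ us)"
    proof (rule closed_path_rotate)
      show "simple_path (\<lambda>a b. {a, b} \<in> E) (us @ w # vs)" using sp uv by simp
      show "{last (w # vs), hd us} \<in> E" if "us \<noteq> []" using cl that unfolding uv by (simp add: hd_append)
    qed
    then have p: "simple_path (\<lambda>a b. {a, b} \<in> E) (vs @ us)" "w \<notin> set (vs @ us)"
      by (auto simp: simple_path_Cons)
    have "z \<noteq> w" using parent_neq[OF zW] by (simp add: w_def)
    then have "length (vs @ us) < k - 1" using p z(1) by (intro sub) (auto simp: uv)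
    then show ?thesis using uv by simp
  qed
qed

text \<open>Edges to parents number at most one per vertex of \<open>W\<close>. The sibling edges
  contain no path on k - 1 vertices, so Erdos-Gallai with t = k - 1 allows (k - 3) / 2 per vertex,
  and 1 + (k - 3) / 2 = (k - 1) / 2.\<close>

lemma edge_count: "2 * card E \<le> (k - 1) * card W"
proof -
  let ?S = "{e \<in> E. \<exists>a b. e = {a, b} \<and> sib E W \<rho> a b}"
  have fW: "finite W" using W finite_subset by blast
  have "E \<subseteq> (\<lambda>a. {a, \<rho> a}) ` W \<union> ?S"
  proof
    fix e assume e: "e \<in> E"
    obtain a b where ab: "e = {a, b}" "a \<in> W" "b = \<rho> a \<or> b \<in> W \<and> \<rho> b = \<rho> a \<and> a \<noteq> b"
      using edge[OF e] by blast
    then show "e \<in> (\<lambda>a. {a, \<rho> a}) ` W \<union> ?S" using e by (auto simp: sib_def)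
  qed
  moreover have SW: "?S \<subseteq> all_edges W"
    using edge_neq by (auto simp: all_edges_def sib_def card_insert_if)
  moreover have "finite ?S" using finite_subset[OF SW finite_all_edges[OF fW]] .
  ultimately have "card E \<le> card ((\<lambda>a. {a, \<rho> a}) ` W \<union> ?S)" using fW by (intro card_mono) auto
  also have "\<dots> \<le> card W + card ?S"
    using card_Un_le[of "(\<lambda>a. {a, \<rho> a}) ` W" ?S] card_image_le[OF fW, of "\<lambda>a. {a, \<rho> a}"] by linarith
  finally have "card E \<le> card W + card ?S" .
  moreover have "2 * card ?S \<le> (k - 1 - 2) * card W"
  proof (rule erdos_gallai_path[OF fW SW])
    fix xs assume xs: "simple_path (\<lambda>a b. {a, b} \<in> ?S) xs"
    have "sib E W \<rho> a b" if "{a, b} \<in> ?S" for a b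
      using that by (auto simp: doubleton_eq_iff intro: sib_sym)
    then have "simple_path (sib E W \<rho>) xs" by (intro simple_path_mono[OF xs])
    then show "length xs < k - 1" by (rule short)
  qed (use k5 in simp)
  moreover have "k - 1 = k - 1 - 2 + 2" using k5 by simp
  then have "(k - 1) * card W = (k - 1 - 2) * card W + 2 * card W"
    by (metis add_mult_distrib)
  ultimately show ?thesis by linarith
qed

end

section \<open>Moves between unrelated vertices are illegal\<close>


definition link :: "nat set set \<Rightarrow> nat \<Rightarrow> nat \<Rightarrow> nat \<Rightarrow> nat list \<Rightarrow> bool" where
  "link E x y l p \<longleftrightarrow> simple_path (\<lambda>a b. {a, b} \<in> E) p \<and> length p = Suc l \<and> hd p = x \<and> last p = y"

lemma link_Cons:
  assumes "link E y z l p" "{x, y} \<in> E" "x \<notin> set p"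
  shows "link E x z (Suc l) (x # p)"
proof -
  have "p \<noteq> []" using assms(1) by (auto simp: link_def)
  then show ?thesis using assms by (auto simp: link_def simple_path_Cons)
qed

lemma link_rev: "link E x y l p \<Longrightarrow> link E y x l (rev p)"
proof -
  assume a: "link E x y l p"
  have "simple_path (\<lambda>a b. {a, b} \<in> E) (rev p)"
    using a simple_path_rev[of "\<lambda>a b. {a, b} \<in> E" p] by (simp add: link_def insert_commute)
  moreover have "p \<noteq> []" using a by (auto simp: link_def)
  ultimately show ?thesis using a by (simp add: link_def hd_rev last_rev)
qed

lemma link_snoc:
  assumes "link E x y l p" "{y, z} \<in> E" "z \<notin> set p"
  shows "link E x z (Suc l) (p @ [z])"
proof -
  have "p \<noteq> []" using assms(1) by (auto simp: link_def)
  then show ?thesis using assms by (simp add: link_def simple_path_append simple_path_Cons)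
qed

lemma link_trans:
  assumes "link E x y l p" "link E y z m q" "set p \<inter> set q \<subseteq> {y}"
  shows "link E x z (l + m) (p @ tl q)"
proof -
  obtain q' where q: "q = y # q'" using assms(2) by (cases q) (auto simp: link_def)
  have p: "p \<noteq> []" "last p = y" using assms(1) by (auto simp: link_def)
  have y: "y \<notin> set q'" and sq: "simple_path (\<lambda>a b. {a, b} \<in> E) q'" "q' \<noteq> [] \<longrightarrow> {y, hd q'} \<in> E"
    using assms(2) by (auto simp: link_def q simple_path_Cons)
  have "simple_path (\<lambda>a b. {a, b} \<in> E) (p @ q')"
    using assms sq p y unfolding simple_path_append by (auto simp: link_def q)
  moreover have "last (p @ q') = z" using assms(2) p by (cases "q' = []") (auto simp: link_def q)
  ultimately show ?thesis using assms(1,2) p by (simp add: link_def q)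
qed

text \<open>The arithmetic of climbing one level: the climb offers all lengths in [1, K], the rest
  of the walk all lengths in [a, b], and the sums fill [a + 1, b + K] without a gap.\<close>

lemma split_length:
  fixes a b K L :: nat
  assumes "Suc a \<le> L" "L \<le> b + K" "a \<le> b" "1 \<le> K"
  obtains L1 L2 where "L = L1 + L2" "1 \<le> L1" "L1 \<le> K" "a \<le> L2" "L2 \<le> b"
proof (cases "L \<le> Suc b")
  case True
  then show ?thesis using assms by (intro that[of 1 "L - 1"]) auto
next
  case False
  then show ?thesis using assms by (intro that[of "L - b" b]) auto
qed

text \<open>The strict order of the tree. Links are required to avoid the descendants of certain
  vertices, which keeps them disjoint from whatever is later attached inside those subtrees.\<close>

inductive descendant :: "nat set \<Rightarrow> (nat \<Rightarrow> nat) \<Rightarrow> nat \<Rightarrow> nat \<Rightarrow> bool" for W \<rho> where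
  "a \<in> W \<Longrightarrow> descendant W \<rho> a (\<rho> a)"
| "a \<in> W \<Longrightarrow> descendant W \<rho> (\<rho> a) c \<Longrightarrow> descendant W \<rho> a c"

lemma full_pathD:
  assumes "full_path E W \<rho> k c xs"
  shows "simple_path (sib E W \<rho>) xs" "length xs = k - 2" "hd xs = c"
    "\<And>a. a \<in> set xs \<Longrightarrow> a \<in> W \<and> \<rho> a = \<rho> c \<and> {a, \<rho> c} \<in> E"
  using assms unfolding full_path_def by blast+

context forest
begin

abbreviation desc :: "nat \<Rightarrow> nat \<Rightarrow> bool" where
  "desc \<equiv> descendant W \<rho>"

lemma desc_iff: "desc a c \<longleftrightarrow> a \<in> W \<and> (\<rho> a = c \<or> desc (\<rho> a) c)"
  by (auto elim: descendant.cases intro: descendant.intros)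

lemma desc_depth: "desc a c \<Longrightarrow> h c < h a"
  by (induction rule: descendant.induct) (simp_all add: depth)

lemma desc_parent: "desc a c \<Longrightarrow> c \<in> W \<Longrightarrow> desc a (\<rho> c)"
  by (induction rule: descendant.induct) (auto intro: descendant.intros)

lemma desc_root: "a \<in> W \<Longrightarrow> desc a r"
proof (induction "h a" arbitrary: a rule: less_induct)
  case less
  show ?case
  proof (cases "\<rho> a = r")
    case True
    then show ?thesis using less.prems desc_iff by blast
  next
    case False
    then have "\<rho> a \<in> W" using parent less.prems by auto
    moreover have "h (\<rho> a) < h a" using depth less.prems by simp
    ultimately show ?thesis using less desc_iff by blast
  qed
qed

lemma full_adj:
  assumes "full E W \<rho> k c"
  shows "c \<in> W" "{c, \<rho> c} \<in> E" "c \<notin> D"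
proof -
  obtain xs where xs: "full_path E W \<rho> k c xs" using assms by (auto simp: full_def)
  have "xs \<noteq> []" using full_pathD(2)[OF xs] k5 by auto
  moreover have "hd xs = c" using xs by (simp add: full_path_def)
  ultimately have "c \<in> set xs" by auto
  then show *: "c \<in> W" "{c, \<rho> c} \<in> E" using full_pathD[OF xs] by blast+
  then show "c \<notin> D" using D_parent D_nonadj by metis
qed

lemma sib_link: "simple_path (sib E W \<rho>) xs \<Longrightarrow> simple_path (\<lambda>a b. {a, b} \<in> E) xs"
  by (erule simple_path_mono) (simp add: sib_def)

lemma full_up_link:
  assumes "full E W \<rho> k c" "1 \<le> l" "l \<le> k - 2"
  obtains p where "link E c (\<rho> c) l p" "\<And>a. a \<in> set p \<Longrightarrow> a = \<rho> c \<or> a \<in> W \<and> \<rho> a = \<rho> c"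
proof -
  obtain xs where xs: "full_path E W \<rho> k c xs" using assms by (auto simp: full_def)
  let ?q = "take l xs"
  have ne: "xs \<noteq> []" "?q \<noteq> []" using full_pathD(2)[OF xs] k5 assms(2) by auto
  have inq: "a \<in> W \<and> \<rho> a = \<rho> c \<and> {a, \<rho> c} \<in> E" if "a \<in> set ?q" for a
    using full_pathD(4)[OF xs, of a] that set_take_subset[of l xs] by blast
  have "simple_path (\<lambda>a b. {a, b} \<in> E) (?q @ drop l xs)"
    using sib_link[OF full_pathD(1)[OF xs]] by simp
  then have sp: "simple_path (\<lambda>a b. {a, b} \<in> E) ?q" unfolding simple_path_append by blast
  have "\<rho> c \<notin> set ?q" using inq parent_neq by metis
  then have "simple_path (\<lambda>a b. {a, b} \<in> E) (?q @ [\<rho> c])"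
    using sp inq ne by (simp add: simple_path_append simple_path_Cons)
  moreover have "hd ?q = c" using full_pathD(3)[OF xs] assms(2) by (simp add: hd_take)
  ultimately have "link E c (\<rho> c) l (?q @ [\<rho> c])"
    using full_pathD(2)[OF xs] assms(3) ne by (simp add: link_def)
  then show ?thesis using inq by (intro that) auto
qed

text \<open>The route goes through the common parent, which sees \<open>x\<close> and all of
  \<open>xs\<close> and so can be left for any vertex of \<open>xs\<close>, followed by a walk back
  to \<open>c\<close>. If \<open>x\<close> lies on \<open>xs\<close> itself, extra length is gained
  by walking away from \<open>c\<close> before jumping to the parent, and the landing vertex is
  chosen before \<open>x\<close>.\<close>

lemma full_across_link:
  assumes xs: "full_path E W \<rho> k c xs" and x: "x \<in> W" "x \<notin> D" "x \<noteq> c" "\<rho> x = \<rho> c" and l: "2 \<le> l" "l \<le> k - 2"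
  obtains p where "link E x c l p" "set p \<subseteq> {x, \<rho> c} \<union> set xs"
proof -
  let ?adj = "\<lambda>a b. {a, b} \<in> E"
  have len: "length xs = k - 2" "hd xs = c" and ne: "xs \<noteq> []" using full_pathD(2,3)[OF xs] k5 by auto
  have inxs: "a \<in> W \<and> \<rho> a = \<rho> c \<and> {a, \<rho> c} \<in> E \<and> {\<rho> c, a} \<in> E" if "a \<in> set xs" for a
    using full_pathD(4)[OF xs that] by (metis insert_commute)
  have wx: "\<rho> c \<notin> set xs" using inxs parent_neq by metis
  have sp: "simple_path ?adj xs" using sib_link[OF full_pathD(1)[OF xs]] by simp
  have xw: "x \<noteq> \<rho> c" "{x, \<rho> c} \<in> E" using x parent_neq up by metis+
  have revp: "simple_path ?adj (rev ys) = simple_path ?adj ys" for ys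
    by (rule simple_path_rev) (simp add: insert_commute)
  have bk: "link E (\<rho> c) c m (\<rho> c # rev (take m xs))" if m: "1 \<le> m" "m \<le> k - 2" for m
  proof -
    have t: "take m xs \<noteq> []" using ne m by simp
    have "simple_path ?adj (take m xs @ drop m xs)" using sp by simp
    then have "simple_path ?adj (rev (take m xs))" unfolding revp simple_path_append by blast
    moreover have "last (take m xs) \<in> set xs" using last_in_set[OF t] set_take_subset by fast
    moreover have "\<rho> c \<notin> set (take m xs)" using wx set_take_subset by fast
    ultimately have "simple_path ?adj (\<rho> c # rev (take m xs))"
      using inxs t by (simp add: simple_path_Cons hd_rev)
    moreover have "hd (take m xs) = c" using len m by (simp add: hd_take)
    ultimately show ?thesis using m len t by (simp add: link_def last_rev)
  qed
  show ?thesis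
  proof (cases "x \<in> set xs")
    case False
    then have "x \<notin> set (\<rho> c # rev (take (l - 1) xs))" using xw set_take_subset[of "l - 1" xs] by auto
    then have "link E x c (Suc (l - 1)) (x # \<rho> c # rev (take (l - 1) xs))"
      using bk[of "l - 1"] l xw by (intro link_Cons) auto
    then show ?thesis using l set_take_subset[of "l - 1" xs] by (intro that) auto
  next
    case True
    then obtain i where i: "i < length xs" "xs ! i = x" by (metis in_set_conv_nth)
    have "i \<noteq> 0" using i x(3) len(2) ne by (metis hd_conv_nth)
    \<comment> \<open>The route has \<open>a\<close> edges beyond \<open>x\<close>, two edges
      through the parent and \<open>b\<close> edges back to \<open>c\<close>. The bound
      \<open>b < i\<close> keeps the two pieces disjoint; taking \<open>b\<close> as large as
      possible keeps \<open>a\<close> small enough for the part of \<open>xs\<close> behind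
      \<open>x\<close>.\<close>
    define b where "b = min (l - 2) (i - 1)"
    define a where "a = l - 2 - b"
    have ab: "a + b = l - 2" "b < i" "a + i < k - 2"
      using i \<open>i \<noteq> 0\<close> l len by (auto simp: a_def b_def min_def)
    let ?q = "take (Suc a) (drop i xs)"
    have q: "?q \<noteq> []" "hd ?q = x" "length ?q = Suc a" using i ab len by (auto simp: hd_take hd_drop_conv_nth)
    have "simple_path ?adj (take i xs @ ?q @ drop (Suc a) (drop i xs))"
      using sp by (simp only: append_take_drop_id)
    then have spq: "simple_path ?adj ?q" unfolding simple_path_append by blast
    have sq: "set ?q \<subseteq> set xs" using set_take_subset set_drop_subset by fast
    have "last ?q \<in> set xs" using last_in_set[OF q(1)] sq by blast
    moreover have "\<rho> c \<notin> set ?q" using wx sq by blast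
    ultimately have "link E x (\<rho> c) (Suc a) (?q @ [\<rho> c])"
      using q spq by (intro link_snoc[of E x "last ?q"]) (auto simp: link_def inxs)
    moreover have "link E (\<rho> c) c (Suc b) (\<rho> c # rev (take (Suc b) xs))"
      using ab by (intro bk) auto
    moreover have "set (?q @ [\<rho> c]) \<inter> set (\<rho> c # rev (take (Suc b) xs)) \<subseteq> {\<rho> c}"
    proof -
      have "distinct (take i xs @ drop i xs)" using sp by (simp add: simple_path_def)
      then have "set (take i xs) \<inter> set (drop i xs) = {}" unfolding distinct_append by blast
      moreover have "set (take (Suc b) xs) \<subseteq> set (take i xs)" using ab by (intro set_take_subset_set_take) simp
      moreover have "set ?q \<subseteq> set (drop i xs)" by (rule set_take_subset)
      ultimately show ?thesis using wx sq by auto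
    qed
    ultimately have "link E x c (Suc a + Suc b) ((?q @ [\<rho> c]) @ tl (\<rho> c # rev (take (Suc b) xs)))"
      by (rule link_trans)
    moreover have "Suc a + Suc b = l" using ab l by simp
    ultimately have "link E x c l (?q @ \<rho> c # rev (take (Suc b) xs))" by simp
    then show ?thesis using sq set_take_subset[of "Suc b" xs] by (intro that) auto
  qed
qed


section \<open>Intervals of realisable link lengths\<close>

definition linked_below :: "nat \<Rightarrow> nat \<Rightarrow> (nat \<Rightarrow> bool) \<Rightarrow> nat \<Rightarrow> bool" where
  "linked_below x y P l \<longleftrightarrow> (\<exists>p. link E x y l p \<and> (\<forall>a\<in>set p. P a))"

lemma range_mono:
  assumes "1 \<le> m"
  shows "Suc m \<le> m * (k - 2)" "Suc m * (k - 2) = m * (k - 2) + (k - 2)"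
proof -
  have "m * 3 \<le> m * (k - 2)" using k5 by (intro mult_le_mono) auto
  then show "Suc m \<le> m * (k - 2)" using assms by linarith
qed simp

text \<open>Each climb to a parent offers 1 to k - 2 edges, and the final crossing to
  \<open>c\<close> between siblings offers 2 to k - 2. With m stages in total this gives
  [m + 1, m (k - 2)]. Avoiding the descendants of \<open>x\<close> carries the induction: the climb
  from \<open>x\<close> uses only siblings, which are descendants of the parent and thus avoided by
  the remaining link.\<close>

lemma links_between_full:
  assumes "full E W \<rho> k c" "full E W \<rho> k x" "x \<noteq> c" "\<not> desc x c" "desc x (\<rho> c)"
  shows "\<exists>m\<ge>1. \<forall>l. Suc m \<le> l \<and> l \<le> m * (k - 2)
           \<longrightarrow> linked_below x c (\<lambda>a. \<not> desc a c \<and> \<not> desc a x) l"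
  using assms(2-5)
proof (induction "h x" arbitrary: x rule: less_induct)
  case (less x)
  note cW = full_adj[OF assms(1)] and xW = full_adj[OF less.prems(1)]
  show ?case
  proof (cases "\<rho> x = \<rho> c")
    case True
    obtain xs where xs: "full_path E W \<rho> k c xs" using assms(1) by (auto simp: full_def)
    have low: "h a \<le> h c" if "a \<in> {x, \<rho> c} \<union> set xs" for a
      using that full_pathD(4)[OF xs, of a] depth[of a] depth[of c] depth[of x] cW(1) xW(1) True by auto
    have hx: "h x = h c" using depth[of c] depth[of x] cW(1) xW(1) True by simp
    have "linked_below x c (\<lambda>a. \<not> desc a c \<and> \<not> desc a x) l" if "Suc 1 \<le> l" "l \<le> 1 * (k - 2)" for l
    proof -
      have l: "2 \<le> l" "l \<le> k - 2" using that by auto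
      obtain p where p: "link E x c l p" "set p \<subseteq> {x, \<rho> c} \<union> set xs"
        using full_across_link[OF xs xW(1,3) less.prems(2) True l] by blast
      have "\<not> desc a c \<and> \<not> desc a x" if "a \<in> set p" for a
        using low[of a] that p(2) desc_depth[of a c] desc_depth[of a x] hx by fastforce
      then show ?thesis using p(1) by (auto simp: linked_below_def)
    qed
    then show ?thesis by blast
  next
    case False
    let ?y = "\<rho> x"
    have dy: "desc ?y (\<rho> c)" using less.prems(4) False desc_iff[of x "\<rho> c"] by blast
    then have yW: "?y \<in> W" using desc_iff by blast
    have yfull: "full E W \<rho> k ?y" using parent_full xW(1) yW by blast
    have yc: "?y \<noteq> c" "\<not> desc ?y c" using less.prems(3) desc_iff[of x c] xW(1) by auto
    obtain m where m: "1 \<le> m" and lk: "\<And>l. Suc m \<le> l \<Longrightarrow> l \<le> m * (k - 2)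
        \<Longrightarrow> linked_below ?y c (\<lambda>a. \<not> desc a c \<and> \<not> desc a ?y) l"
      using less.hyps[of ?y, OF _ yfull yc dy] depth[OF xW(1)] by auto
    have "linked_below x c (\<lambda>a. \<not> desc a c \<and> \<not> desc a x) l"
      if l: "Suc (Suc m) \<le> l" "l \<le> Suc m * (k - 2)" for l
    proof -
      obtain l1 l2 where ll: "l = l1 + l2" "1 \<le> l1" "l1 \<le> k - 2" "Suc m \<le> l2" "l2 \<le> m * (k - 2)"
      proof (rule split_length)
        show "Suc (Suc m) \<le> l" by (rule l(1))
        show "l \<le> m * (k - 2) + (k - 2)" using l(2) range_mono(2)[OF m] by linarith
        show "Suc m \<le> m * (k - 2)" by (rule range_mono(1)[OF m])
        show "1 \<le> k - 2" using k5 by simp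
      qed
      obtain q where q: "link E ?y c l2 q" "\<And>a. a \<in> set q \<Longrightarrow> \<not> desc a c \<and> \<not> desc a ?y"
        using lk[OF ll(4,5)] by (auto simp: linked_below_def)
      obtain p where p: "link E x ?y l1 p" "\<And>a. a \<in> set p \<Longrightarrow> a = ?y \<or> a \<in> W \<and> \<rho> a = ?y"
        using full_up_link[OF less.prems(1) ll(2,3)] by blast
      have "a = ?y" if "a \<in> set p" "a \<in> set q" for a
        using p(2)[OF that(1)] q(2)[OF that(2)] by (metis descendant.intros(1))
      then have "set p \<inter> set q \<subseteq> {?y}" by auto
      then have "link E x c l (p @ tl q)" using link_trans[OF p(1) q(1)] ll(1) by simp
      moreover have "\<not> desc a c \<and> \<not> desc a x" if "a \<in> set (p @ tl q)" for a
      proof -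
        have "a \<in> set p \<or> a \<in> set q" using that set_drop_subset[of 1 q] by (auto simp: drop_Suc)
        then show ?thesis
        proof
          assume "a \<in> set q"
          then show ?thesis using q(2)[of a] desc_parent[of a x] xW(1) by blast
        next
          assume "a \<in> set p"
          then have a: "a = ?y \<or> a \<in> W \<and> \<rho> a = ?y" by (rule p(2))
          then have "\<not> desc a c" using yc desc_iff[of a c] by metis
          moreover have "h a \<le> h x" using a depth xW(1) by auto
          ultimately show ?thesis using desc_depth[of a x] by auto
        qed
      qed
      ultimately show ?thesis by (auto simp: linked_below_def)
    qed
    then show ?thesis using m by (intro exI[of _ "Suc m"]) auto
  qed
qed

end

text \<open>A neighbour has the same label as \<open>d\<close>, so injectivity of the labels keeps
  it out of \<open>D\<close>. Were it full, putting \<open>d\<close> in front of its full path would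
  give k - 1 siblings in a row.\<close>

lemma (in good) nbr_of_D:
  assumes "d \<in> D" "{d, b} \<in> E"
  shows "sib E W \<rho> d b" "b \<notin> D" "\<not> full E W \<rho> k b"
proof -
  have dW: "d \<in> W" and dr: "\<rho> d = r" using assms D D_parent by auto
  have nr: "b \<noteq> r" using D_nonadj assms by auto
  show s: "sib E W \<rho> d b"
    using related[OF assms(2)] dr nr parent_full[of b] dW full_adj(3)[of d] assms(1) by auto
  have "\<rho> b = r" using s dr by (auto simp: sib_def)
  show bD: "b \<notin> D"
    using label[OF s dr] inj_onD[OF label_inj, of d b] assms(1) edge_neq[OF assms(2)] by blast
  show "\<not> full E W \<rho> k b"
  proof
    assume "full E W \<rho> k b"
    then obtain xs where xs: "full_path E W \<rho> k b xs" by (auto simp: full_def)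
    have "d \<notin> set xs" using full_pathD(4)[OF xs, of d] dr D_nonadj[OF assms(1)] \<open>\<rho> b = r\<close> by auto
    then have "simple_path (sib E W \<rho>) (d # xs)"
      using full_pathD(1,3)[OF xs] s by (simp add: simple_path_Cons)
    then show False using short[of "d # xs"] full_pathD(2)[OF xs] k5 by simp
  qed
qed

context good
begin

text \<open>This induction climbs from \<open>c\<close>, while \<open>links_between_full\<close>
  climbs from the other end. The value \<epsilon> = 1 stands for one forced edge at
  \<open>x\<close>: from a vertex of \<open>D\<close> to its neighbour, or to the parent of
  \<open>x\<close> when \<open>x\<close> hangs below another child of \<open>\<rho> c\<close>. Such
  an \<open>x\<close> need not be full, so only its parent offers a choice of lengths.\<close>

lemma links_to_full:
  assumes "full E W \<rho> k c" "x \<in> insert r W" "x \<noteq> c" "\<not> desc x c"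
  shows "\<exists>m\<ge>1. \<exists>\<epsilon>\<le>1. \<forall>l. Suc m + \<epsilon> \<le> l \<and> l \<le> m * (k - 2) + \<epsilon> \<longrightarrow> linked_below x c (\<lambda>a. \<not> desc a c) l"
  using assms(1,3,4)
proof (induction "h c" arbitrary: c rule: less_induct)
  case (less c)
  note cW = full_adj[OF less.prems(1)]
  let ?w = "\<rho> c"
  have up_ok: "\<not> desc a c" if "a = ?w \<or> a \<in> W \<and> \<rho> a = ?w" for a
  proof -
    have "h a \<le> h c" using that depth[of a] depth[OF cW(1)] by auto
    then show ?thesis using desc_depth[of a c] by auto
  qed
  consider "x = ?w" | "x \<in> W" "\<rho> x = ?w" | "x \<noteq> ?w" "\<not> desc x ?w" | "x \<in> W" "\<rho> x \<noteq> ?w" "desc x ?w"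
    using desc_iff[of x ?w] by blast
  then show ?case
  proof cases
    case 1
    have "linked_below x c (\<lambda>a. \<not> desc a c) l" if l: "Suc 1 + 0 \<le> l" "l \<le> 1 * (k - 2) + 0" for l
    proof -
      obtain p where "link E c ?w l p" "\<And>a. a \<in> set p \<Longrightarrow> a = ?w \<or> a \<in> W \<and> \<rho> a = ?w"
        using full_up_link[OF less.prems(1), of l] l by auto
      then show ?thesis using link_rev up_ok 1 unfolding linked_below_def by (metis set_rev)
    qed
    then show ?thesis by blast
  next
    case 2
    obtain xs where xs: "full_path E W \<rho> k c xs" using less.prems(1) by (auto simp: full_def)
    have ok: "\<not> desc a c" if "a \<in> {y, ?w} \<union> set xs" "\<rho> y = ?w" "y \<in> W" for a y
      using that full_pathD(4)[OF xs, of a] up_ok[of a] by auto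
    show ?thesis
    proof (cases "x \<in> D")
      case False
      have "linked_below x c (\<lambda>a. \<not> desc a c) l" if l: "Suc 1 + 0 \<le> l" "l \<le> 1 * (k - 2) + 0" for l
      proof -
        have l': "2 \<le> l" "l \<le> k - 2" using l by auto
        obtain p where "link E x c l p" "set p \<subseteq> {x, ?w} \<union> set xs"
          using full_across_link[OF xs 2(1) False less.prems(2) 2(2) l'] by blast
        then show ?thesis using ok 2 unfolding linked_below_def by blast
      qed
      then show ?thesis by blast
    next
      case True
      obtain b where b: "b \<in> W" "{x, b} \<in> E" using D_nbr[OF True] by auto
      note bs = nbr_of_D[OF True b(2)]
      have br: "\<rho> b = ?w" using bs(1) 2 by (auto simp: sib_def)
      have bc: "b \<noteq> c" using bs(3) less.prems(1) by auto
      have "?w = r" using D_parent[OF True] 2 by simp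
      then have xn: "x \<notin> {b, ?w} \<union> set xs"
        using edge_neq[OF b(2)] 2 rW D_nonadj[OF True] full_pathD(4)[OF xs, of x] by auto
      have "linked_below x c (\<lambda>a. \<not> desc a c) l" if l: "Suc 1 + 1 \<le> l" "l \<le> 1 * (k - 2) + 1" for l
      proof -
        have l': "2 \<le> l - 1" "l - 1 \<le> k - 2" "Suc (l - 1) = l" using l by auto
        obtain p where p: "link E b c (l - 1) p" "set p \<subseteq> {b, ?w} \<union> set xs"
          using full_across_link[OF xs b(1) bs(2) bc br l'(1,2)] by blast
        then have "link E x c l (x # p)" using link_Cons[OF p(1) b(2)] xn l'(3) by auto
        moreover have "\<not> desc a c" if "a \<in> set (x # p)" for a
          using that p(2) ok[of a b] br b(1) up_ok[of x] 2 by auto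
        ultimately show ?thesis unfolding linked_below_def by blast
      qed
      then show ?thesis by (intro exI[of _ 1]) auto
    qed
  next
    case 3
    have wW: "?w \<in> W"
    proof (rule ccontr)
      assume "?w \<notin> W"
      then have "?w = r" using parent cW(1) by auto
      then show False using 3 assms(2) desc_root by auto
    qed
    have wfull: "full E W \<rho> k ?w" using parent_full cW(1) wW by blast
    obtain m \<epsilon> where m: "1 \<le> m" "\<epsilon> \<le> 1" and lk: "\<And>l. Suc m + \<epsilon> \<le> l \<Longrightarrow> l \<le> m * (k - 2) + \<epsilon>
        \<Longrightarrow> linked_below x ?w (\<lambda>a. \<not> desc a ?w) l"
      using less.hyps[of ?w, OF _ wfull 3] depth[OF cW(1)] by auto
    have "linked_below x c (\<lambda>a. \<not> desc a c) l"
      if l: "Suc (Suc m) + \<epsilon> \<le> l" "l \<le> Suc m * (k - 2) + \<epsilon>" for l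
    proof -
      obtain l1 l2 where ll: "l = l1 + l2" "1 \<le> l1" "l1 \<le> k - 2" "Suc m + \<epsilon> \<le> l2" "l2 \<le> m * (k - 2) + \<epsilon>"
      proof (rule split_length)
        show "Suc (Suc m + \<epsilon>) \<le> l" using l(1) by simp
        show "l \<le> m * (k - 2) + \<epsilon> + (k - 2)" using l(2) range_mono(2)[OF m(1)] by linarith
        show "Suc m + \<epsilon> \<le> m * (k - 2) + \<epsilon>" using range_mono(1)[OF m(1)] by simp
        show "1 \<le> k - 2" using k5 by simp
      qed
      obtain q where q: "link E x ?w l2 q" "\<And>a. a \<in> set q \<Longrightarrow> \<not> desc a ?w"
        using lk[OF ll(4,5)] by (auto simp: linked_below_def)
      obtain p where p: "link E c ?w l1 p" "\<And>a. a \<in> set p \<Longrightarrow> a = ?w \<or> a \<in> W \<and> \<rho> a = ?w"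
        using full_up_link[OF less.prems(1) ll(2,3)] by blast
      have "a = ?w" if "a \<in> set p" "a \<in> set q" for a
        using p(2)[OF that(1)] q(2)[OF that(2)] by (metis descendant.intros(1))
      then have "set q \<inter> set (rev p) \<subseteq> {?w}" by auto
      then have "link E x c l (q @ tl (rev p))" using link_trans[OF q(1) link_rev[OF p(1)]] ll(1) by (simp add: add.commute)
      moreover have "\<not> desc a c" if "a \<in> set (q @ tl (rev p))" for a
      proof -
        have "a \<in> set q \<or> a \<in> set p" using that set_drop_subset[of 1 "rev p"] by (auto simp: drop_Suc)
        then show ?thesis using q(2)[of a] p(2)[of a] up_ok[of a] desc_parent[of a c] cW(1) by blast
      qed
      ultimately show ?thesis unfolding linked_below_def by blast
    qed
    then show ?thesis using m by (intro exI[of _ "Suc m"] conjI exI[of _ \<epsilon>]) auto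
  next
    case 4
    let ?y = "\<rho> x"
    have dy: "desc ?y ?w" using 4 desc_iff[of x ?w] by blast
    then have yW: "?y \<in> W" using desc_iff by blast
    have yfull: "full E W \<rho> k ?y" using parent_full 4(1) yW by blast
    have yc: "?y \<noteq> c" "\<not> desc ?y c" using less.prems(3) desc_iff[of x c] 4(1) by auto
    obtain m where m: "1 \<le> m" and lk: "\<And>l. Suc m \<le> l \<Longrightarrow> l \<le> m * (k - 2)
        \<Longrightarrow> linked_below ?y c (\<lambda>a. \<not> desc a c \<and> \<not> desc a ?y) l"
      using links_between_full[OF less.prems(1) yfull yc dy] by auto
    have "?y \<noteq> r" using yW rW by auto
    then have xD: "x \<notin> D" using D_parent by auto
    have "linked_below x c (\<lambda>a. \<not> desc a c) l" if l: "Suc m + 1 \<le> l" "l \<le> m * (k - 2) + 1" for l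
    proof -
      have "Suc m \<le> l - 1" "l - 1 \<le> m * (k - 2)" using l by auto
      from lk[OF this] obtain q where
          q: "link E ?y c (l - 1) q" "\<And>a. a \<in> set q \<Longrightarrow> \<not> desc a c \<and> \<not> desc a ?y"
        by (auto simp: linked_below_def)
      have "x \<notin> set q" using q(2)[of x] desc_iff[of x ?y] 4(1) by auto
      then have "link E x c l (x # q)" using link_Cons[OF q(1) up[OF 4(1) xD]] l by simp
      then show ?thesis using q(2) less.prems(3) unfolding linked_below_def by (metis set_ConsD)
    qed
    then show ?thesis using m by (intro exI[of _ m]) auto
  qed
qed

text \<open>Let y be the end of larger depth. Its parent c is full, and a link from x to c that
  avoids the descendants of c, followed by the edge from c to y and the new edge, forms a cycle. The
  available lengths fill an interval that contains a forbidden one.\<close>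

lemma unrelated_move_illegal:
  assumes dense: "dense_family k C"
    and xy: "x \<in> insert r W" "y \<in> insert r W" "x \<noteq> y"
    and unrel: "\<not> (x \<in> W \<and> \<rho> x = y)" "\<not> (y \<in> W \<and> \<rho> y = x)" "\<not> (x \<in> W \<and> y \<in> W \<and> \<rho> x = \<rho> y)"
  shows "\<not> free_of C ({..<n}, insert {x, y} E)"
proof -
  have *: "\<not> free_of C ({..<n}, insert {x, y} E)"
    if xy: "x \<in> insert r W" "y \<in> insert r W" "x \<noteq> y"
      and unrel: "\<not> (y \<in> W \<and> \<rho> y = x)" "\<not> (x \<in> W \<and> y \<in> W \<and> \<rho> x = \<rho> y)"
      and hxy: "h x \<le> h y" for x y
  proof -
    let ?c = "\<rho> y"
    have yW: "y \<in> W"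
    proof (rule ccontr)
      assume "y \<notin> W"
      then have "y = r" "x \<in> W" using xy by auto
      then show False using hxy depth_root depth[of x] by simp
    qed
    \<comment> \<open>If the parent of y were the root, then y would have depth 1, and x, being no
      deeper, would be the root or a sibling of y.\<close>
    have cW: "?c \<in> W"
    proof (rule ccontr)
      assume "?c \<notin> W"
      then have cr: "?c = r" using parent yW by auto
      then have "h y = 1" using depth[OF yW] depth_root by simp
      then show False
        using xy unrel hxy cr yW depth[of x] depth[of "\<rho> x"] parent[of x] by fastforce
    qed
    have cfull: "full E W \<rho> k ?c" using parent_full yW cW by blast
    have xc: "x \<noteq> ?c" using unrel yW by auto
    have xnd: "\<not> desc x ?c"
    proof
      assume "desc x ?c"
      then have "x \<in> W" "\<rho> x = ?c \<or> desc (\<rho> x) ?c" using desc_iff[of x ?c] by auto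
      moreover have "\<not> desc (\<rho> x) ?c"
        using desc_depth[of "\<rho> x" ?c] depth[of x] depth[of y] hxy yW \<open>x \<in> W\<close> by auto
      ultimately show False using unrel yW by auto
    qed
    obtain m \<epsilon> where m: "1 \<le> m" "\<epsilon> \<le> 1" and lk: "\<And>l. Suc m + \<epsilon> \<le> l \<Longrightarrow> l \<le> m * (k - 2) + \<epsilon>
        \<Longrightarrow> linked_below x ?c (\<lambda>a. \<not> desc a ?c) l"
      using links_to_full[OF cfull xy(1) xc xnd] by auto
    have yD: "y \<notin> D" using D_parent[of y] cW rW by auto
    have cyc_ex: "\<exists>p. cyc (insert {x, y} E) p \<and> length p = l"
      if l: "m + 3 + \<epsilon> \<le> l" "l \<le> m * (k - 2) + 2 + \<epsilon>" for l
    proof -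
      have "Suc m + \<epsilon> \<le> l - 2" "l - 2 \<le> m * (k - 2) + \<epsilon>" using l by auto
      from lk[OF this] obtain q where q: "link E x ?c (l - 2) q" "\<And>a. a \<in> set q \<Longrightarrow> \<not> desc a ?c"
        by (auto simp: linked_below_def)
      have "y \<notin> set q" using q(2)[of y] desc_iff[of y ?c] yW by auto
      moreover have "{?c, y} \<in> E" using up[OF yW yD] by (simp add: insert_commute)
      ultimately have "link E x y (Suc (l - 2)) (q @ [y])" by (intro link_snoc[OF q(1)])
      then have "cyc (insert {x, y} E) (q @ [y])"
        using l m unfolding cyc_def link_def
        by (auto intro: simple_path_mono simp: insert_commute)
      moreover have "length (q @ [y]) = l" using q(1) l by (simp add: link_def)
      ultimately show ?thesis by blast
    qed
    have "\<exists>l. m + 3 + \<epsilon> \<le> l \<and> l \<le> m * (k - 2) + 2 + \<epsilon> \<and> cycle_graph l \<in> C"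
    proof (cases "\<epsilon> = 0 \<and> m = 1")
      case True
      then show ?thesis using dense k5 by (intro exI[of _ k]) (auto simp: dense_family_def)
    next
      case False
      \<comment> \<open>With this \<open>s\<close> the lower end s + 2 of condition (3) is the lower
        end of the interval. The upper ends agree for \<epsilon> = 1 and leave a slack of k - 3 for
        \<epsilon> = 0. The excluded case m = 1, \<epsilon> = 0 would need s = 2; there the interval
        is [4, k] and contains k itself.\<close>
      define s where "s = m + 1 + \<epsilon>"
      have "3 \<le> s" using False m by (auto simp: s_def)
      then obtain l where l: "s + 2 \<le> l" "l \<le> 3 + (k - 2) * (s - 2)" "cycle_graph l \<in> C"
        using dense unfolding dense_family_def by blast
      have "3 + (k - 2) * (s - 2) \<le> m * (k - 2) + 2 + \<epsilon>"
      proof (cases "\<epsilon> = 0")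
        case True
        obtain m' where m': "m = Suc m'" using m by (cases m) auto
        then show ?thesis using True k5 by (simp add: s_def algebra_simps)
      next
        case False
        then have "\<epsilon> = 1" using m by simp
        then show ?thesis using m by (simp add: s_def algebra_simps)
      qed
      then show ?thesis using l by (intro exI[of _ l]) (auto simp: s_def)
    qed
    then obtain l p where l: "cycle_graph l \<in> C" "cyc (insert {x, y} E) p" "length p = l"
      using cyc_ex by blast
    have "set p \<subseteq> {..<n}"
    proof (rule cyc_subset[OF l(2)])
      fix e assume "e \<in> insert {x, y} E"
      then show "e \<subseteq> {..<n}" using edges_subset xy W r by (auto simp: all_edges_def)
    qed
    then show ?thesis using cyc_not_free l by blast
  qed
  show ?thesis
  proof (cases "h x \<le> h y")
    case True
    then show ?thesis using *[of x y] xy unrel by auto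
  next
    case False
    then show ?thesis using *[of y x] xy unrel by (auto simp: insert_commute)
  qed
qed

end

section \<open>Local modifications of a position\<close>


text \<open>Fullness depends only on siblings of \<open>c\<close> that are adjacent to the parent,
  so only these have to keep their place. A vertex of \<open>D\<close> is not among them and may
  therefore be moved.\<close>

lemma full_mono:
  assumes "full E W \<rho> k c" "3 \<le> k" "E \<subseteq> E'"
    and "\<And>a. a \<in> W \<Longrightarrow> \<rho> a = \<rho> c \<Longrightarrow> {a, \<rho> c} \<in> E \<Longrightarrow> a \<in> W' \<and> \<rho>' a = \<rho> a"
  shows "full E' W' \<rho>' k c"
proof -
  obtain xs where xs: "full_path E W \<rho> k c xs" using assms(1) by (auto simp: full_def)
  have in_xs: "a \<in> W' \<and> \<rho>' a = \<rho> c \<and> {a, \<rho> c} \<in> E'" if "a \<in> set xs" for a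
    using full_pathD(4)[OF xs that] assms(3,4) by auto
  have "xs \<noteq> []" using full_pathD(2)[OF xs] assms(2) by auto
  then have c: "\<rho>' c = \<rho> c" using in_xs[of c] full_pathD(3)[OF xs] by auto
  have "simple_path (sib E' W' \<rho>') xs"
    by (rule simple_path_mono[OF full_pathD(1)[OF xs]]) (use in_xs assms(3) in \<open>auto simp: sib_def\<close>)
  then show ?thesis using full_pathD(2,3)[OF xs] in_xs c unfolding full_def full_path_def by auto
qed

lemma neighbours_of_inner:
  assumes "simple_path R xs" "d \<in> set xs" "d \<noteq> hd xs" "d \<noteq> last xs"
  obtains a b where "a \<noteq> b" "R a d" "R d b" "a \<in> set xs" "b \<in> set xs"
proof -
  obtain us vs where uv: "xs = us @ d # vs" using assms(2) by (metis split_list)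
  have ne: "us \<noteq> []" "vs \<noteq> []" using assms(3,4) uv by auto
  then have "last us \<in> set us" "hd vs \<in> set vs" by auto
  moreover have "set us \<inter> set vs = {}" "R (last us) d" "R d (hd vs)"
    using assms(1) ne unfolding uv simple_path_append simple_path_Cons by auto
  ultimately show ?thesis using uv by (intro that[of "last us" "hd vs"]) auto
qed

context forest
begin

lemma forest_sib_edge:
  assumes "x \<in> W" "y \<in> W" "x \<noteq> y" "\<rho> x = \<rho> y"
  shows "forest k n r (insert {x, y} E) W \<rho> h D"
proof (rule forest.intro)
  fix e assume "e \<in> insert {x, y} E"
  then show "\<exists>a b. e = {a, b} \<and> a \<in> W \<and> (b = \<rho> a \<or> b \<in> W \<and> \<rho> b = \<rho> a \<and> a \<noteq> b)"
  proof (cases "e = {x, y}")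
    case True
    then show ?thesis using assms by - (rule exI[of _ x], rule exI[of _ y], simp)
  next
    case False
    then show ?thesis using edge[of e] \<open>e \<in> insert {x, y} E\<close> by simp
  qed
next
  fix d assume "d \<in> D"
  then show "\<exists>b\<in>W. {d, b} \<in> insert {x, y} E" "{d, r} \<notin> insert {x, y} E"
    using D_nbr[of d] D_nonadj[of d] assms(1,2) rW unfolding insert_iff doubleton_eq_iff by blast+
next
  fix a assume "a \<in> W" "\<rho> a \<in> W"
  then show "full (insert {x, y} E) W \<rho> k (\<rho> a)"
    using k5 by (intro full_mono[OF parent_full]) auto
qed (fact k5 W r parent depth_root depth D D_parent | simp add: up)+

lemma forest_root_edge:
  assumes "d \<in> D"
  shows "forest k n r (insert {r, d} E) W \<rho> h (D - {d})"
proof (rule forest.intro)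
  fix e assume "e \<in> insert {r, d} E"
  moreover have "\<exists>a b. {r, d} = {a, b} \<and> a \<in> W \<and> (b = \<rho> a \<or> b \<in> W \<and> \<rho> b = \<rho> a \<and> a \<noteq> b)"
    using D_parent[OF assms] D assms by - (rule exI[of _ d], rule exI[of _ r], auto)
  ultimately show "\<exists>a b. e = {a, b} \<and> a \<in> W \<and> (b = \<rho> a \<or> b \<in> W \<and> \<rho> b = \<rho> a \<and> a \<noteq> b)"
    using edge by blast
next
  fix d' assume "d' \<in> D - {d}"
  then show "\<exists>b\<in>W. {d', b} \<in> insert {r, d} E" "{d', r} \<notin> insert {r, d} E"
    using D_nbr[of d'] D_nonadj[of d'] unfolding insert_iff doubleton_eq_iff by blast+
next
  fix a assume "a \<in> W" "\<rho> a \<in> W"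
  then show "full (insert {r, d} E) W \<rho> k (\<rho> a)"
    using k5 by (intro full_mono[OF parent_full]) auto
next
  fix a assume "a \<in> W" "a \<notin> D - {d}"
  then show "{a, \<rho> a} \<in> insert {r, d} E"
    using up[of a] D_parent[OF assms] by (cases "a = d") (auto simp: insert_commute)
qed (fact k5 W r parent depth_root depth | use D D_parent in blast)+

lemma sib_root_edge: "sib (insert {r, d} E) W \<rho> = sib E W \<rho>"
  using rW by (intro ext) (auto simp: sib_def doubleton_eq_iff)

text \<open>Parents in \<open>W\<close> are full and full vertices lie outside \<open>D\<close>, so
  \<open>y\<close> has no children and only one depth changes. As \<open>y\<close> is pendant, its
  single edge becomes its parent edge, and it leaves \<open>D\<close> without a new edge.\<close>

lemma forest_reparent:
  assumes y: "y \<in> D" and b: "full E W \<rho> k b" "{y, b} \<in> E" and pendant: "\<And>b'. {y, b'} \<in> E \<Longrightarrow> b' = b"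
  shows "forest k n r E W (\<rho>(y := b)) (h(y := Suc (h b))) (D - {y})"
proof -
  let ?\<rho> = "\<rho>(y := b)" and ?h = "h(y := Suc (h b))"
  have yW: "y \<in> W" and yr: "y \<noteq> r" using y D rW by auto
  have bW: "b \<in> W" using full_adj[OF b(1)] by simp
  have childless: "\<rho> a \<noteq> y" if "a \<in> W" for a
    using parent_full[OF that] full_adj(3)[of y] y yW by auto
  have by_neq: "b \<noteq> y" using edge_neq[OF b(2)] by auto
  have full': "full E W ?\<rho> k c" if "full E W \<rho> k c" for c
  proof (rule full_mono[OF that])
    fix a assume "a \<in> W" "\<rho> a = \<rho> c" "{a, \<rho> c} \<in> E"
    then have "a \<noteq> y" using D_parent[OF y] D_nonadj[OF y] by metis
    then show "a \<in> W \<and> ?\<rho> a = \<rho> a" using \<open>a \<in> W\<close> by simp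
  qed (use k5 in auto)
  show ?thesis
  proof (rule forest.intro)
    fix e assume e: "e \<in> E"
    then obtain a c where ac: "e = {a, c}" "a \<in> W" "c = \<rho> a \<or> c \<in> W \<and> \<rho> c = \<rho> a \<and> a \<noteq> c"
      using edge by blast
    show "\<exists>a c. e = {a, c} \<and> a \<in> W \<and> (c = ?\<rho> a \<or> c \<in> W \<and> ?\<rho> c = ?\<rho> a \<and> a \<noteq> c)"
    proof (cases "y \<in> e")
      case True
      then have "e = {y, b}" using ac(1) e pendant by (auto simp: insert_commute)
      then show ?thesis using yW by - (rule exI[of _ y], rule exI[of _ b], auto)
    next
      case False
      then show ?thesis using ac by - (rule exI[of _ a], rule exI[of _ c], auto)
    qed
  next
    fix a assume a: "a \<in> W"
    show "?h a = Suc (?h (?\<rho> a))" using depth[OF a] childless[OF a] by_neq by auto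
  next
    fix a assume "a \<in> W" "?\<rho> a \<in> W"
    then show "full E W ?\<rho> k (?\<rho> a)" using parent_full[of a] full' b(1) by auto
  next
    fix a assume "a \<in> W" "a \<notin> D - {y}"
    then show "{a, ?\<rho> a} \<in> E" using up[of a] b(2) by auto
  qed (use k5 W r parent depth_root D D_parent D_nbr D_nonadj yr bW in auto)
qed

lemma sib_reparent:
  assumes y: "y \<in> D" and b: "b \<in> W" and pendant: "\<And>b'. {y, b'} \<in> E \<Longrightarrow> b' = b"
    and s: "sib E W (\<rho>(y := b)) u v"
  shows "sib E W \<rho> u v \<and> u \<noteq> y \<and> v \<noteq> y"
proof -
  have uv: "{u, v} \<in> E" "u \<noteq> v" using s edge_neq by (auto simp: sib_def)
  have "u \<noteq> y"
  proof
    assume "u = y"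
    then have "v = b" using uv pendant by auto
    then show False using s uv \<open>u = y\<close> parent_neq[OF b] by (auto simp: sib_def)
  qed
  moreover have "v \<noteq> y"
  proof
    assume "v = y"
    then have "u = b" using uv pendant[of u] by (simp add: insert_commute)
    then show False using s uv \<open>v = y\<close> parent_neq[OF b] by (auto simp: sib_def)
  qed
  ultimately show ?thesis using s by (auto simp: sib_def)
qed

end

definition Good :: "nat \<Rightarrow> nat \<Rightarrow> nat set set \<Rightarrow> bool" where
  "Good k n E \<longleftrightarrow> (\<exists>r W \<rho> h D \<kappa>. good k n r E W \<rho> h D \<kappa>)"

lemma short_if_not_exact:
  assumes "\<And>zs. simple_path R zs \<Longrightarrow> length zs = m \<Longrightarrow> False" "simple_path R xs"
  shows "length xs < m"
proof (rule ccontr)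
  assume "\<not> length xs < m"
  moreover have "simple_path R (take m xs @ drop m xs)" using assms(2) by simp
  then have "simple_path R (take m xs)" unfolding simple_path_append by blast
  ultimately show False using assms(1)[of "take m xs"] by simp
qed

section \<open>Paying a debt and absorbing an isolated vertex\<close>

context good
begin

text \<open>A root edge is never a sibling edge, so path lengths and labels stay as they are. Mini
  has such a safe move whenever \<open>D\<close> is non-empty.\<close>

lemma good_root_edge:
  assumes "d \<in> D"
  shows "good k n r (insert {r, d} E) W \<rho> h (D - {d}) \<kappa>"
proof (intro good.intro good_axioms.intro forest_root_edge assms)
  fix d' b b' assume "k = 5" "d' \<in> D - {d}" "{d', b} \<in> insert {r, d} E" "{d', b'} \<in> insert {r, d} E"
  moreover have "d' \<noteq> r" using \<open>d' \<in> D - {d}\<close> D rW by auto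
  ultimately show "b = b'" using five[of d' b b'] by (auto simp: doubleton_eq_iff)
qed (use sib_root_edge[of d] short label label_inj in \<open>auto intro: inj_on_subset\<close>)

lemma fresh_vertex:
  assumes "z \<notin> insert r W" shows "{z, b} \<notin> E" "{b, z} \<notin> E"
  using edge_vertices[of z b] edge_vertices[of b z] assms by auto

text \<open>The new vertex forms a block of its own below \<open>u\<close> and has no sibling
  neighbours. The label \<open>l\<close> is left open because \<open>isolated_step\<close> needs a
  fresh one, for a vertex that gains a sibling right away.\<close>

lemma good_leaf:
  assumes z: "z \<notin> insert r W" "z < n" and u: "u = r \<or> full E W \<rho> k u"
  shows "good k n r (insert {z, u} E) (insert z W) (\<rho>(z := u)) (h(z := Suc (h u))) D (\<kappa>(z := l))"
proof -
  let ?E = "insert {z, u} E" and ?W = "insert z W" and ?\<rho> = "\<rho>(z := u)" and ?h = "h(z := Suc (h u))"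
  have uW: "u \<in> insert r W" and uD: "u \<notin> D" using u full_adj[of u] D rW by auto
  have zu: "z \<noteq> u" using z uW by auto
  have full': "full ?E ?W ?\<rho> k c" if "full E W \<rho> k c" for c
    by (rule full_mono[OF that]) (use k5 z in auto)
  have no_child: "\<rho> a \<noteq> z" if "a \<in> W" for a using parent[OF that] z by auto
  have sib_z: "sib E W \<rho> a b \<and> a \<noteq> z \<and> b \<noteq> z" if "sib ?E ?W ?\<rho> a b" for a b
  proof -
    have ab: "a \<in> ?W" "b \<in> ?W" "?\<rho> a = ?\<rho> b" "{a, b} \<in> ?E" using that by (auto simp: sib_def)
    have "{a, b} \<noteq> {z, u}"
    proof
      assume "{a, b} = {z, u}"
      then have "\<rho> u = u" "u \<in> W" using ab zu by (auto simp: doubleton_eq_iff split: if_splits)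
      then show False using parent_neq by auto
    qed
    then have e: "{a, b} \<in> E" using ab by auto
    then have "a \<noteq> z" "b \<noteq> z" using fresh_vertex[OF z(1)] by auto
    then show ?thesis using ab e by (auto simp: sib_def)
  qed
  have f: "forest k n r ?E ?W ?\<rho> ?h D"
  proof (rule forest.intro)
    fix e assume "e \<in> ?E"
    then consider "e = {z, u}" | "e \<in> E" by auto
    then show "\<exists>a b. e = {a, b} \<and> a \<in> ?W \<and> (b = ?\<rho> a \<or> b \<in> ?W \<and> ?\<rho> b = ?\<rho> a \<and> a \<noteq> b)"
    proof cases
      case 1
      then show ?thesis by - (rule exI[of _ z], rule exI[of _ u], auto)
    next
      case 2
      then obtain a b where ab: "e = {a, b}" "a \<in> W" "b = \<rho> a \<or> b \<in> W \<and> \<rho> b = \<rho> a \<and> a \<noteq> b"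
        using edge by blast
      moreover have "a \<noteq> z" "b \<noteq> z" using 2 ab(1) fresh_vertex[OF z(1)] by metis+
      ultimately show ?thesis by - (rule exI[of _ a], rule exI[of _ b], auto)
    qed
  next
    fix a assume "a \<in> ?W"
    then show "?h a = Suc (?h (?\<rho> a))" using depth[of a] no_child[of a] zu by auto
  next
    fix a assume "a \<in> ?W" "?\<rho> a \<in> ?W"
    then show "full ?E ?W ?\<rho> k (?\<rho> a)"
      using parent_full[of a] full' u no_child[of a] zu rW z by (cases "a = z") auto
  next
    fix a assume "a \<in> ?W" "a \<notin> D"
    then show "{a, ?\<rho> a} \<in> ?E" using up[of a] by auto
  next
    fix d assume d: "d \<in> D"
    then show "{d, r} \<notin> ?E" using D_nonadj[of d] uD D z by (auto simp: doubleton_eq_iff)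
    show "?\<rho> d = r" using d D_parent D z by auto
    show "\<exists>b\<in>?W. {d, b} \<in> ?E" using d D_nbr by blast
  qed (use k5 W r parent depth_root depth D uW z in auto)
  show ?thesis
  proof (intro good.intro good_axioms.intro f)
    fix xs assume xs: "simple_path (sib ?E ?W ?\<rho>) xs"
    have "simple_path (sib E W \<rho>) xs" by (rule simple_path_mono[OF xs]) (use sib_z in blast)
    then show "length xs < k - 1" by (rule short)
  next
    fix a b assume "sib ?E ?W ?\<rho> a b" "?\<rho> a = r"
    then show "(\<kappa>(z := l)) a = (\<kappa>(z := l)) b" using sib_z[of a b] label[of a b] by auto
  next
    have "z \<notin> D" using D z by auto
    then show "inj_on (\<kappa>(z := l)) D" using label_inj by (auto simp: inj_on_def)
  next
    fix d b b' assume d: "k = 5" "d \<in> D" "{d, b} \<in> ?E" "{d, b'} \<in> ?E"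
    moreover have "d \<noteq> z" "d \<noteq> u" using d D z uD by auto
    ultimately show "b = b'" using five[of d b b'] by (auto simp: doubleton_eq_iff)
  qed
qed

text \<open>This is why a new leaf \<open>z\<close> attached to a vertex \<open>u\<close> that is not full can be made a sibling of \<open>u\<close>.\<close>

lemma short_new_sibling:
  assumes u: "\<not> full E W \<rho> k u" "u \<in> W" and lab: "\<And>d. \<rho> u = r \<Longrightarrow> d \<in> D \<Longrightarrow> \<kappa> d \<noteq> \<kappa> u"
    and zW: "z \<notin> W"
    and old: "\<And>a b. a \<noteq> z \<Longrightarrow> b \<noteq> z \<Longrightarrow> R a b \<Longrightarrow> sib E W \<rho> a b"
    and new: "\<And>b. R z b \<Longrightarrow> b = u" and sym: "\<And>a b. R a b \<Longrightarrow> R b a"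
    and xs: "simple_path R xs"
  shows "length xs < k - 1"
proof (rule short_if_not_exact[OF _ xs])
  fix zs assume zs: "simple_path R zs" "length zs = k - 1"
  \<comment> \<open>The only sibling neighbour of \<open>z\<close> is \<open>u\<close>, so
    \<open>z\<close> can only be an end of such a path. The other k - 2 vertices start at
    \<open>u\<close>; at the root they share its label, hence avoid \<open>D\<close>, and so witness
    that \<open>u\<close> is full.\<close>
  have contra: False if zs: "simple_path R (z # ys)" "length (z # ys) = k - 1" for ys
  proof -
    have ys: "z \<notin> set ys" "simple_path R ys" "ys \<noteq> []" "R z (hd ys)" "length ys = k - 2"
      using zs k5 by (auto simp: simple_path_Cons)
    have sp: "simple_path (sib E W \<rho>) ys"
      by (rule simple_path_mono[OF ys(2)]) (use ys(1) in \<open>auto intro: old\<close>)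
    have h: "hd ys = u" using new ys(4) by auto
    then have u_in: "u \<in> set ys" using ys(3) by auto
    have "set ys \<subseteq> W" using sib_path_subset[OF sp] ys(5) k5 by simp
    moreover have par: "\<rho> a = \<rho> u" if "a \<in> set ys" for a using sib_path_const[OF sp that u_in] .
    moreover have "a \<notin> D" if a: "a \<in> set ys" for a
    proof
      assume aD: "a \<in> D"
      then have "\<rho> u = r" using D_parent par[OF a] by simp
      moreover have "\<kappa> a = \<kappa> u"
      proof (rule successively_invariant[where xs = ys and P = \<kappa>])
        fix p q assume "p \<in> set ys" "q \<in> set ys" "sib E W \<rho> p q"
        then show "\<kappa> p = \<kappa> q" using label[of p q] par[of p] \<open>\<rho> u = r\<close> by simp
      qed (use sp a u_in in \<open>auto simp: simple_path_def\<close>)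
      ultimately show False using lab aD by auto
    qed
    ultimately have "full_path E W \<rho> k u ys"
      using sp ys(5) h up unfolding full_path_def by (metis subsetD)
    then show False using u(1) by (auto simp: full_def)
  qed
  show False
  proof (cases "z \<in> set zs")
    case False
    have "simple_path (sib E W \<rho>) zs"
      by (rule simple_path_mono[OF zs(1)]) (use False in \<open>auto intro: old\<close>)
    then show False using short zs(2) by force
  next
    case True
    consider "z = hd zs" | "z = last zs" | "z \<noteq> hd zs" "z \<noteq> last zs" by blast
    then show False
    proof cases
      case 1
      then show False using contra[of "tl zs"] zs k5 by (cases zs) auto
    next
      case 2
      have "simple_path R (rev zs)" using zs simple_path_rev[of R] sym by blast
      moreover have "rev zs = z # tl (rev zs)" using 2 zs(2) k5 by (cases zs rule: rev_cases) auto
      ultimately show False using contra[of "tl (rev zs)"] zs(2) by (metis length_rev)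
    next
      case 3
      then show False using neighbours_of_inner[OF zs(1) True] new sym by metis
    qed
  qed
qed

lemma forest_new_sibling:
  assumes z: "z \<notin> insert r W" "z < n" and u: "u \<in> W" "u \<notin> D"
    and cases: "E' = insert {z, \<rho> u} (insert {z, u} E) \<and> D' = D \<or> E' = insert {z, u} E \<and> D' = insert z D \<and> \<rho> u = r"
  shows "forest k n r E' (insert z W) (\<rho>(z := \<rho> u)) (h(z := h u)) D'"
proof -
  let ?W = "insert z W" and ?\<rho> = "\<rho>(z := \<rho> u)" and ?h = "h(z := h u)"
  have sub: "E \<subseteq> E'" "{z, u} \<in> E'" "E' \<subseteq> insert {z, \<rho> u} (insert {z, u} E)" using cases by auto
  have zu: "z \<noteq> u" "z \<noteq> \<rho> u" using z u parent[of u] by auto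
  have full': "full E' ?W ?\<rho> k c" if "full E W \<rho> k c" for c
    by (rule full_mono[OF that]) (use k5 z sub in auto)
  have no_child: "\<rho> a \<noteq> z" if "a \<in> W" for a using parent[OF that] z by auto
  show ?thesis
  proof (rule forest.intro)
    fix e assume "e \<in> E'"
    then consider "e = {z, u}" | "e = {z, \<rho> u}" | "e \<in> E" using sub by auto
    then show "\<exists>a b. e = {a, b} \<and> a \<in> ?W \<and> (b = ?\<rho> a \<or> b \<in> ?W \<and> ?\<rho> b = ?\<rho> a \<and> a \<noteq> b)"
    proof cases
      case 1
      then show ?thesis using zu u by - (rule exI[of _ z], rule exI[of _ u], auto)
    next
      case 2
      then show ?thesis by - (rule exI[of _ z], rule exI[of _ "\<rho> u"], auto)
    next
      case 3
      then obtain a b where ab: "e = {a, b}" "a \<in> W" "b = \<rho> a \<or> b \<in> W \<and> \<rho> b = \<rho> a \<and> a \<noteq> b"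
        using edge by blast
      moreover have "a \<noteq> z" "b \<noteq> z" using 3 ab(1) fresh_vertex[OF z(1)] by metis+
      ultimately show ?thesis by - (rule exI[of _ a], rule exI[of _ b], auto)
    qed
  next
    fix a assume "a \<in> ?W"
    then show "?h a = Suc (?h (?\<rho> a))" using depth[of a] depth[OF u(1)] no_child[of a] zu by auto
  next
    fix a assume "a \<in> ?W" "?\<rho> a \<in> ?W"
    then show "full E' ?W ?\<rho> k (?\<rho> a)"
      using parent_full[of a] parent_full[of u] full' no_child[of a] zu u by (cases "a = z") auto
  next
    fix a assume "a \<in> ?W" "a \<notin> D'"
    then show "{a, ?\<rho> a} \<in> E'" using up[of a] cases by (cases "a = z") auto
  next
    fix d assume d: "d \<in> D'"
    then consider (fresh) "d = z" "E' = insert {z, u} E" "\<rho> u = r" | (old) "d \<in> D" "d \<noteq> z" using cases D z by auto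
    then have "{d, r} \<notin> E' \<and> ?\<rho> d = r \<and> (\<exists>b\<in>?W. {d, b} \<in> E')"
    proof cases
      case fresh
      have "u \<noteq> r" using u rW by auto
      then show ?thesis using fresh fresh_vertex(1)[OF z(1), of r] u zu(1) by (auto simp: doubleton_eq_iff)
    next
      case old
      obtain b where "b \<in> W" "{d, b} \<in> E" using D_nbr[OF old(1)] by blast
      moreover have "{d, r} \<noteq> {z, u}" "{d, r} \<noteq> {z, \<rho> u}" using old(2) z by (auto simp: doubleton_eq_iff)
      ultimately show ?thesis using D_nonadj[OF old(1)] D_parent[OF old(1)] old(2) sub by auto
    qed
    then show "{d, r} \<notin> E'" "?\<rho> d = r" "\<exists>b\<in>?W. {d, b} \<in> E'" by blast+
  qed (use k5 W r parent depth_root depth D u z cases in auto)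
qed

text \<open>Away from the root a child must see its parent, so the edge from \<open>z\<close> to
  \<open>\<rho> u\<close> is added as well. Below the root, \<open>z\<close> becomes the vertex of
  \<open>D\<close> of a component that had none by \<open>lab\<close>; its only neighbour is then
  \<open>u\<close>, as \<open>five\<close> requires.\<close>

lemma good_new_sibling:
  assumes z: "z \<notin> insert r W" "z < n" and u: "u \<in> W" "\<not> full E W \<rho> k u"
    and lab: "\<And>d. \<rho> u = r \<Longrightarrow> d \<in> D \<Longrightarrow> \<kappa> d \<noteq> \<kappa> u"
    and cases: "E' = insert {z, \<rho> u} (insert {z, u} E) \<and> D' = D \<and> \<rho> u \<noteq> r
      \<or> E' = insert {z, u} E \<and> D' = insert z D \<and> \<rho> u = r"
  shows "good k n r E' (insert z W) (\<rho>(z := \<rho> u)) (h(z := h u)) D' (\<kappa>(z := \<kappa> u))"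
proof -
  let ?W = "insert z W" and ?\<rho> = "\<rho>(z := \<rho> u)" and ?h = "h(z := h u)" and ?\<kappa> = "\<kappa>(z := \<kappa> u)"
  have sub: "E \<subseteq> E'" "{z, u} \<in> E'" "E' \<subseteq> insert {z, \<rho> u} (insert {z, u} E)" using cases by auto
  have uD: "u \<notin> D" using lab[of u] D_parent[of u] by auto
  have zu: "z \<noteq> u" "z \<noteq> \<rho> u" using z u parent[of u] by auto
  have new: "b = u" if "sib E' ?W ?\<rho> z b" for b
  proof -
    have "{z, b} \<in> E'" "b \<in> ?W" "?\<rho> b = \<rho> u" using that by (auto simp: sib_def)
    moreover have "b \<noteq> \<rho> u" using calculation parent_neq[of "\<rho> u"] zu by auto
    ultimately show ?thesis using sub fresh_vertex[OF z(1), of b] by (auto simp: doubleton_eq_iff)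
  qed
  have old: "sib E W \<rho> a b" if "a \<noteq> z" "b \<noteq> z" "sib E' ?W ?\<rho> a b" for a b
    using that sub by (auto simp: sib_def doubleton_eq_iff)
  show ?thesis
  proof (intro good.intro good_axioms.intro)
    show "forest k n r E' ?W ?\<rho> ?h D'" using cases by (intro forest_new_sibling z u(1) uD) auto
    fix xs assume "simple_path (sib E' ?W ?\<rho>) xs"
    then show "length xs < k - 1"
      using z by (intro short_new_sibling[OF u(2,1) lab _ old new sib_sym]) auto
  next
    fix a b assume s: "sib E' ?W ?\<rho> a b" "?\<rho> a = r"
    consider "a = z" | "b = z" | "a \<noteq> z" "b \<noteq> z" by blast
    then show "?\<kappa> a = ?\<kappa> b"
    proof cases
      case 1
      then have "b = u" using new[of b] s(1) by simp
      then show ?thesis using 1 by simp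
    next
      case 2
      then have "a = u" using new[of a] sib_sym[OF s(1)] by simp
      then show ?thesis using 2 by simp
    next
      case 3
      then show ?thesis using label[OF old[OF 3 s(1)]] s(2) by simp
    qed
  next
    have "z \<notin> D" using D z by auto
    moreover have "\<kappa> d \<noteq> \<kappa> u \<and> \<kappa> u \<noteq> \<kappa> d" if "\<rho> u = r" "d \<in> D" for d using lab[OF that] by simp
    ultimately show "inj_on ?\<kappa> D'"
      using cases inj_onD[OF label_inj] unfolding inj_on_def fun_upd_def by (smt (verit) insert_iff)
  next
    fix d b b' assume d: "k = 5" "d \<in> D'" "{d, b} \<in> E'" "{d, b'} \<in> E'"
    show "b = b'"
    proof (cases "d = z")
      case True
      then have "E' = insert {z, u} E" using d cases D z by auto
      then show ?thesis using d True fresh_vertex[OF z(1)] by (auto simp: doubleton_eq_iff)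
    next
      case False
      then have dD: "d \<in> D" using d cases by auto
      then have "d \<noteq> u" "d \<noteq> \<rho> u \<or> \<rho> u = r" "d \<noteq> r" 
        using uD parent_full[OF u(1)] full_adj(3)[of "\<rho> u"] D rW by auto
      then have "{d, b} \<in> E" "{d, b'} \<in> E" using d sub False by (auto simp: doubleton_eq_iff)
      then show ?thesis using five d(1) dD by blast
    qed
  qed
qed

end

section \<open>Joining two siblings\<close>


lemma simple_path_all:
  assumes "simple_path R xs" "2 \<le> length xs" "\<And>a b. R a b \<Longrightarrow> P a \<and> P b" "a \<in> set xs"
  shows "P a"
proof -
  obtain j where j: "j < length xs" "a = xs ! j" using assms(4) by (metis in_set_conv_nth)
  show ?thesis
  proof (cases "Suc j < length xs")
    case True
    then show ?thesis using simple_path_nth[OF assms(1) True] assms(3) j by blast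
  next
    case False
    then have "Suc (j - 1) < length xs" "Suc (j - 1) = j" using j assms(2) by auto
    then show ?thesis using simple_path_nth[OF assms(1), of "j - 1"] assms(3) j by metis
  qed
qed

text \<open>Max joins two siblings. A bad path is one that would form a cycle of length \<open>k\<close> through the parent
  if its ends were adjacent to the parent; it splits at the new edge into two arms.\<close>

locale sib_move = good +
  fixes x y :: nat and C :: "graph set"
  assumes xW: "x \<in> W" and yW: "y \<in> W" and xy: "x \<noteq> y" and par_eq: "\<rho> x = \<rho> y"
    and Ck: "cycle_graph k \<in> C" and Ck1: "k \<noteq> 5 \<Longrightarrow> cycle_graph (Suc k) \<in> C"
    and free: "free_of C ({..<n}, insert {x, y} E)"
begin

abbreviation E' :: "nat set set" where "E' \<equiv> insert {x, y} E"

abbreviation arm :: "nat \<Rightarrow> nat list \<Rightarrow> bool" where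
  "arm z L \<equiv> simple_path (sib E W \<rho>) L \<and> L \<noteq> [] \<and> hd L = z"

abbreviation bad :: "nat list \<Rightarrow> bool" where
  "bad zs \<equiv> simple_path (sib E' W \<rho>) zs \<and> length zs = k - 1"

lemma forest': "forest k n r E' W \<rho> h D"
  by (rule forest_sib_edge[OF xW yW xy par_eq])

sublocale F: forest k n r E' W \<rho> h D
  by (rule forest')

lemma sib'_iff: "sib E' W \<rho> a b \<longleftrightarrow> sib E W \<rho> a b \<or> a = x \<and> b = y \<or> a = y \<and> b = x"
  using xW yW par_eq by (auto simp: sib_def doubleton_eq_iff)

text \<open>Ends outside \<open>D\<close> are both adjacent to the common parent, which closes the
  path to a cycle with one more vertex. Length k is always forbidden, length k + 1 only guaranteed
  for k \<noteq> 5.\<close>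

lemma no_real_ends:
  assumes zs: "simple_path (sib E' W \<rho>) zs" "length zs = k - 1 \<or> k \<noteq> 5 \<and> length zs = k"
    and ends: "hd zs \<notin> D" "last zs \<notin> D"
  shows False
proof -
  let ?w = "\<rho> (hd zs)"
  have len: "2 \<le> length zs" and ne: "zs \<noteq> []" using zs(2) k5 by auto
  have W: "set zs \<subseteq> W" using sib_path_subset[OF zs(1) len] .
  have par: "\<rho> a = ?w" if "a \<in> set zs" for a
    by (rule sib_path_const[OF zs(1) that]) (use ne in simp)
  have ends_W: "hd zs \<in> W" "last zs \<in> W" using W ne by auto
  have "\<rho> (last zs) = ?w" by (rule par) (use ne in simp)
  then have "{last zs, ?w} \<in> E'" using F.up[OF ends_W(2) ends(2)] by simp
  moreover have "{hd zs, ?w} \<in> E'" by (rule F.up[OF ends_W(1) ends(1)])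
  moreover have "?w \<notin> set zs" using par[of ?w] parent_neq[of ?w] W by blast
  moreover have "simple_path (\<lambda>a b. {a, b} \<in> E') zs" using F.sib_link[OF zs(1)] .
  ultimately have c: "cyc E' (?w # zs)"
    using ne len by (simp add: cyc_def simple_path_Cons insert_commute)
  have "set (?w # zs) \<subseteq> {..<n}"
    by (rule cyc_subset[OF c]) (use F.edges_subset in \<open>auto simp: all_edges_def\<close>)
  moreover have "cycle_graph (length (?w # zs)) \<in> C" using zs(2) Ck Ck1 k5 by auto
  ultimately show False using cyc_not_free[OF c] free by blast
qed

text \<open>By \<open>short\<close> the path must use the new edge, and it does so only once.
  Cutting there leaves two old sibling paths, read outwards from \<open>x\<close> and from
  \<open>y\<close>.\<close>

lemma bad_decomp:
  assumes "bad zs"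
  obtains L1 L2 where "arm x L1" "arm y L2" "set L1 \<inter> set L2 = {}" "zs = rev L1 @ L2 \<or> zs = rev L2 @ L1"
proof -
  have d: "distinct zs" using assms by (simp add: simple_path_def)
  have "\<not> simple_path (sib E W \<rho>) zs" using short[of zs] assms by auto
  then have "\<not> successively (sib E W \<rho>) zs" using d by (simp add: simple_path_def)
  then obtain i where i: "Suc i < length zs" "\<not> sib E W \<rho> (zs ! i) (zs ! Suc i)"
    by (auto simp: successively_conv_nth)
  have "sib E' W \<rho> (zs ! i) (zs ! Suc i)" using simple_path_nth i(1) assms by blast
  then have e: "zs ! i = x \<and> zs ! Suc i = y \<or> zs ! i = y \<and> zs ! Suc i = x" using i(2) sib'_iff by blast
  let ?A = "take (Suc i) zs" and ?B = "drop (Suc i) zs"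
  have "simple_path (sib E' W \<rho>) (?A @ ?B)" using assms by simp
  then have AB: "simple_path (sib E' W \<rho>) ?A" "simple_path (sib E' W \<rho>) ?B" "set ?A \<inter> set ?B = {}"
    unfolding simple_path_append by blast+
  have ne: "?A \<noteq> []" "?B \<noteq> []" using i(1) by auto
  have lA: "last ?A = zs ! i" using i(1) by (simp add: take_Suc_conv_app_nth)
  have hB: "hd ?B = zs ! Suc i" using i(1) by (simp add: hd_drop_conv_nth)
  have mem: "zs ! i \<in> set ?A" "zs ! Suc i \<in> set ?B"
    using last_in_set[OF ne(1)] list.set_sel(1)[OF ne(2)] lA hB by metis+
  have A: "simple_path (sib E W \<rho>) ?A"
  proof (rule simple_path_mono[OF AB(1)])
    fix a b assume "a \<in> set ?A" "b \<in> set ?A" "sib E' W \<rho> a b"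
    then show "sib E W \<rho> a b" using mem(2) AB(3) e sib'_iff by (metis disjoint_iff)
  qed
  have B: "simple_path (sib E W \<rho>) ?B"
  proof (rule simple_path_mono[OF AB(2)])
    fix a b assume "a \<in> set ?B" "b \<in> set ?B" "sib E' W \<rho> a b"
    then show "sib E W \<rho> a b" using mem(1) AB(3) e sib'_iff by (metis disjoint_iff)
  qed
  have revA: "simple_path (sib E W \<rho>) (rev ?A)" "hd (rev ?A) = zs ! i" "rev ?A \<noteq> []"
    using A lA ne by (simp_all add: sib_path_rev hd_rev)
  have z: "zs = rev (rev ?A) @ ?B" by simp
  from e show ?thesis
  proof
    assume "zs ! i = x \<and> zs ! Suc i = y"
    then show ?thesis using that[of "rev ?A" ?B] revA B hB ne AB(3) z by auto
  next
    assume "zs ! i = y \<and> zs ! Suc i = x"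
    then show ?thesis using that[of ?B "rev ?A"] revA B hB ne AB(3) z by auto
  qed
qed

lemma arm_parent:
  assumes "arm z L" "z \<in> W" "a \<in> set L"
  shows "a \<in> W \<and> \<rho> a = \<rho> z"
proof -
  have "(a \<in> W \<and> \<rho> a = \<rho> z) = (z \<in> W \<and> \<rho> z = \<rho> z)"
  proof (rule successively_invariant[where xs = L and P = "\<lambda>a. a \<in> W \<and> \<rho> a = \<rho> z"])
    show "z \<in> set L" using assms by auto
    show "successively (sib E W \<rho>) L" using assms(1) by (simp add: simple_path_def)
  qed (use assms(3) in \<open>simp_all add: sib_def\<close>)
  then show ?thesis using assms by simp
qed

lemma arm_label:
  assumes "arm z L" "z \<in> W" "\<rho> z = r" "a \<in> set L"
  shows "\<kappa> a = \<kappa> z"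
proof (rule successively_invariant[where xs = L and P = \<kappa>])
  show "z \<in> set L" using assms by auto
  fix p q assume "p \<in> set L" "q \<in> set L" "sib E W \<rho> p q"
  then show "\<kappa> p = \<kappa> q" using label[of p q] arm_parent[OF assms(1,2), of p] assms(3) by simp
next
  show "successively (sib E W \<rho>) L" using assms(1) by (simp add: simple_path_def)
qed (use assms(4) in simp)

lemma bad_vertices:
  assumes "bad zs" "a \<in> set zs"
  shows "a \<in> W" "\<rho> a = \<rho> x" "\<rho> x = r \<Longrightarrow> \<kappa> a = \<kappa> x \<or> \<kappa> a = \<kappa> y"
proof -
  obtain L1 L2 where L: "arm x L1" "arm y L2" "zs = rev L1 @ L2 \<or> zs = rev L2 @ L1"
    using bad_decomp[OF assms(1)] by metis
  then have "a \<in> set L1 \<or> a \<in> set L2" using assms(2) by auto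
  then show "a \<in> W" "\<rho> a = \<rho> x" "\<rho> x = r \<Longrightarrow> \<kappa> a = \<kappa> x \<or> \<kappa> a = \<kappa> y"
    using arm_parent[OF L(1) xW] arm_parent[OF L(2) yW] arm_label[OF L(1) xW] arm_label[OF L(2) yW] par_eq
    by metis+
qed

text \<open>The vertices in \<open>X\<close> are those that stop being children of the root.\<close>

lemma GoodI:
  assumes f: "forest k n r E'' W \<rho>' h' D'"
    and sib': "\<And>a b. sib E'' W \<rho>' a b \<Longrightarrow> sib E' W \<rho> a b \<and> a \<notin> X \<and> b \<notin> X"
    and no_bad: "\<And>zs. bad zs \<Longrightarrow> set zs \<inter> X \<noteq> {}"
    and par: "\<And>a. a \<notin> X \<Longrightarrow> \<rho>' a = \<rho> a" and sub: "D' \<subseteq> D"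
    and uniq: "\<And>d d'. \<rho> x = r \<Longrightarrow> d \<in> D' \<Longrightarrow> d' \<in> D' \<Longrightarrow> \<kappa> d \<in> {\<kappa> x, \<kappa> y} \<Longrightarrow> \<kappa> d' \<in> {\<kappa> x, \<kappa> y} \<Longrightarrow> d = d'"
    and nbr: "\<And>d b. k = 5 \<Longrightarrow> d \<in> D' \<Longrightarrow> {d, b} \<in> E'' \<Longrightarrow> {d, b} \<in> E"
  shows "Good k n E''"
proof -
  \<comment> \<open>The new edge merges the components of \<open>x\<close> and \<open>y\<close> if
    they are children of the root, so the label of \<open>y\<close> is replaced by that of
    \<open>x\<close>.\<close>
  define \<kappa>' where "\<kappa>' = (\<lambda>a. if \<rho> x = r \<and> \<kappa> a = \<kappa> y then \<kappa> x else \<kappa> a)"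
  have "good k n r E'' W \<rho>' h' D' \<kappa>'"
  proof (intro good.intro good_axioms.intro f)
    fix xs assume xs: "simple_path (sib E'' W \<rho>') xs"
    show "length xs < k - 1"
    proof (rule short_if_not_exact[OF _ xs])
      fix zs assume zs: "simple_path (sib E'' W \<rho>') zs" "length zs = k - 1"
      have "simple_path (sib E' W \<rho>) zs" by (rule simple_path_mono[OF zs(1)]) (use sib' in blast)
      moreover have "a \<notin> X" if "a \<in> set zs" for a
        using simple_path_all[OF zs(1), of "\<lambda>a. a \<notin> X"] that sib' zs(2) k5 by auto
      ultimately show False using no_bad zs(2) by blast
    qed
  next
    fix a b assume s: "sib E'' W \<rho>' a b" "\<rho>' a = r"
    then have s': "sib E' W \<rho> a b" "\<rho> a = r" using sib' par by auto
    from s'(1) consider "sib E W \<rho> a b" | "a = x" "b = y" | "a = y" "b = x" using sib'_iff by blast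
    then show "\<kappa>' a = \<kappa>' b"
      using s'(2) label[of a b] par_eq unfolding \<kappa>'_def by cases auto
  next
    show "inj_on \<kappa>' D'"
    proof (rule inj_onI)
      fix d d' assume d: "d \<in> D'" "d' \<in> D'" "\<kappa>' d = \<kappa>' d'"
      have old: "d = d'" if "\<kappa> d = \<kappa> d'" using inj_onD[OF label_inj that] d sub by blast
      show "d = d'"
      proof (cases "\<rho> x = r \<and> \<kappa> d \<in> {\<kappa> x, \<kappa> y} \<and> \<kappa> d' \<in> {\<kappa> x, \<kappa> y}")
        case True
        then show ?thesis using uniq d(1,2) by blast
      next
        case False
        then have "\<kappa> d = \<kappa> d'" using d(3) unfolding \<kappa>'_def by (auto split: if_split_asm)
        then show ?thesis by (rule old)
      qed
    qed
  next
    fix d b b' assume "k = 5" "d \<in> D'" "{d, b} \<in> E''" "{d, b'} \<in> E''"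
    then show "b = b'" using nbr five[of d b b'] sub by blast
  qed
  then show ?thesis unfolding Good_def by blast
qed

text \<open>Every vertex of a bad path is in the block of \<open>x\<close> and, at the root, has the
  label of \<open>x\<close> or \<open>y\<close>. So it is not in \<open>D\<close>, and the path
  would close a forbidden cycle. This covers all blocks not hanging from the root.\<close>

lemma Good_no_D:
  assumes "\<And>d. \<rho> x = r \<Longrightarrow> d \<in> D \<Longrightarrow> \<kappa> d \<noteq> \<kappa> x \<and> \<kappa> d \<noteq> \<kappa> y"
  shows "Good k n E'"
proof (rule GoodI[where X = "{}"])
  show "forest k n r E' W \<rho> h D" by (rule forest')
  fix zs assume b: "bad zs"
  have "a \<notin> D" if "a \<in> set zs" for a
    using bad_vertices[OF b that] assms[of a] D_parent[of a] by auto
  moreover have "zs \<noteq> []" using b k5 by auto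
  ultimately show "set zs \<inter> {} \<noteq> {}" using no_real_ends[of zs] b by auto
next
  fix d b assume d: "k = 5" "d \<in> D" "{d, b} \<in> E'"
  have "d \<noteq> x" "d \<noteq> y" using d(2) assms[of d] D_parent[of d] par_eq by auto
  then show "{d, b} \<in> E" using d(3) by (auto simp: doubleton_eq_iff)
qed (use assms in auto)

text \<open>Without a bad path the root edge of \<open>d\<close> is played. Otherwise every bad path
  has \<open>d\<close> as an end, and the rest of it shows that the neighbour of \<open>d\<close> is
  full. A second neighbour of \<open>d\<close> would give a path of k - 1 siblings with no end in
  \<open>D\<close>, so \<open>d\<close> is pendant and can be moved below that neighbour; every bad
  path is destroyed with it.\<close>

lemma Good_one_D:
  assumes root: "\<rho> x = r" and d: "d \<in> D"
    and uniq: "\<And>d'. d' \<in> D \<Longrightarrow> \<kappa> d' \<in> {\<kappa> x, \<kappa> y} \<Longrightarrow> d' = d"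
  shows "Good k n E' \<or> Good k n (insert {r, d} E')"
proof (cases "\<exists>zs. bad zs")
  case False
  have "Good k n (insert {r, d} E')"
  proof (rule GoodI[where X = "{}"])
    show "forest k n r (insert {r, d} E') W \<rho> h (D - {d})" by (rule F.forest_root_edge[OF d])
  next
    fix d' b assume d': "k = 5" "d' \<in> D - {d}" "{d', b} \<in> insert {r, d} E'"
    then have "d' \<noteq> x" "d' \<noteq> y" "d' \<noteq> r" using uniq[of d'] D rW by auto
    then show "{d', b} \<in> E" using d' by (auto simp: doubleton_eq_iff)
  qed (use False F.sib_root_edge[of d] uniq in auto)
  then show ?thesis ..
next
  case True
  have inD: "a = d" if "bad zs" "a \<in> set zs" "a \<in> D" for zs a
    using bad_vertices(3)[OF that(1,2) root] uniq[OF that(3)] by auto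
  have has_d: "hd zs = d \<or> last zs = d" if "bad zs" for zs
  proof -
    have "zs \<noteq> []" using that k5 by auto
    then show ?thesis using no_real_ends[of zs] that inD[OF that, of "hd zs"] inD[OF that, of "last zs"] by auto
  qed
  obtain zs where zs: "bad zs" "hd zs = d"
  proof -
    obtain zs0 where z0: "bad zs0" using True by blast
    then have "bad (rev zs0)" by (simp add: sib_path_rev)
    then show ?thesis using has_d[OF z0] that[of zs0] that[of "rev zs0"] z0 by (auto simp: hd_rev)
  qed
  then obtain ys where ys: "zs = d # ys" using k5 by (cases zs) auto
  have yl: "length ys = k - 2" and yne: "ys \<noteq> []" using zs ys k5 by auto
  have yp: "simple_path (sib E' W \<rho>) ys" and dn: "d \<notin> set ys" and dh: "sib E' W \<rho> d (hd ys)"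
    using zs(1) yne unfolding ys simple_path_Cons by auto
  have yD: "a \<notin> D" if "a \<in> set ys" for a using inD[OF zs(1), of a] that dn ys by auto
  let ?a = "hd ys"
  have pendant: "c = ?a" if c: "{d, c} \<in> E'" for c
  proof (rule ccontr)
    assume ca: "c \<noteq> ?a"
    have dc: "sib E' W \<rho> d c"
    proof (cases "{d, c} \<in> E")
      case True
      then show ?thesis using nbr_of_D(1)[OF d] sib'_iff by blast
    next
      case False
      then show ?thesis using c sib'_iff by (auto simp: doubleton_eq_iff)
    qed
    have cD: "c \<notin> D"
    proof (cases "{d, c} \<in> E")
      case True
      then show ?thesis using nbr_of_D(2)[OF d] by blast
    next
      case False
      then have "c = x \<or> c = y" using c by (auto simp: doubleton_eq_iff)
      moreover have "c \<noteq> d" using F.edge_neq[OF c] by simp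
      ultimately show ?thesis using uniq[of c] by auto
    qed
    have cd: "sib E' W \<rho> c d" using sib_sym[OF dc] .
    show False
    \<comment> \<open>If \<open>c\<close> lies on \<open>ys\<close>, the part before
      \<open>c\<close> is reversed, so that \<open>d\<close> is passed between \<open>?a\<close> and
      \<open>c\<close>. If not, the path starts with \<open>c\<close> and \<open>d\<close> and gives
      up the last vertex of \<open>ys\<close>. Both have k - 1 vertices and no end in
      \<open>D\<close>.\<close>
    proof (cases "c \<in> set ys")
      case True
      then obtain us vs where uv: "ys = us @ c # vs" by (metis split_list)
      have une: "us \<noteq> []" using ca uv by auto
      have hu: "hd us = ?a" using une uv by simp
      have p: "simple_path (sib E' W \<rho>) us" "simple_path (sib E' W \<rho>) (c # vs)" "set us \<inter> set (c # vs) = {}"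
        using yp unfolding uv simple_path_append by blast+
      have dn': "d \<notin> set us" "d \<notin> set (c # vs)" using dn uv by auto
      have "simple_path (sib E' W \<rho>) (rev us)" using p(1) by (simp only: sib_path_rev)
      moreover have "simple_path (sib E' W \<rho>) (d # c # vs)"
        using p(2) dc dn'(2) simple_path_Cons[of _ d "c # vs"] by simp
      moreover have "set (rev us) \<inter> set (d # c # vs) = {}" using p(3) dn'(1) by auto
      moreover have "sib E' W \<rho> (last (rev us)) (hd (d # c # vs))"
        using sib_sym[OF dh] hu une by (simp add: last_rev)
      ultimately have "simple_path (sib E' W \<rho>) (rev us @ d # c # vs)"
        using simple_path_append by blast
      moreover have "length (rev us @ d # c # vs) = k - 1" using yl uv k5 by simp
      moreover have "hd (rev us @ d # c # vs) = last us" using une by (simp add: hd_rev)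
      moreover have "last (rev us @ d # c # vs) = last ys" using uv by simp
      ultimately show False
        using no_real_ends[of "rev us @ d # c # vs"] yD[of "last us"] yD[of "last ys"] une uv yne by auto
    next
      case False
      let ?q = "c # d # butlast ys"
      have b: "butlast ys \<noteq> []" using yl k5 by (cases ys rule: rev_cases) auto
      have split: "ys = butlast ys @ [last ys]" using yne by simp
      have "simple_path (sib E' W \<rho>) (butlast ys)" using yp split simple_path_append by metis
      moreover have "hd (butlast ys) = ?a" using split b by (metis hd_append2)
      moreover have "set (butlast ys) \<subseteq> set ys" using in_set_butlastD by fastforce
      moreover have "c \<noteq> d" using F.edge_neq[OF c] by auto
      ultimately have "simple_path (sib E' W \<rho>) ?q"
        using cd dh dn False by (auto simp: simple_path_Cons)
      moreover have "length ?q = k - 1" using yl k5 by simp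
      moreover have "last ?q \<notin> D" using b yD[of "last (butlast ys)"] in_set_butlastD[OF last_in_set[OF b]] by simp
      ultimately show False using no_real_ends[of ?q] cD by simp
    qed
  qed
  have fa: "full E' W \<rho> k ?a"
  proof -
    have W: "set ys \<subseteq> W" using sib_path_subset[OF yp] yl k5 by simp
    have "\<rho> a = \<rho> ?a" if "a \<in> set ys" for a 
      by (rule sib_path_const[OF yp that]) (use yne in simp)
    then have "full_path E' W \<rho> k ?a ys"
      using yp yl W F.up yD unfolding full_path_def by (metis subsetD)
    then show ?thesis by (auto simp: full_def)
  qed
  have da: "{d, ?a} \<in> E'" using dh by (simp add: sib_def)
  have "Good k n E'"
  proof (rule GoodI[where X = "{d}"])
    show "forest k n r E' W (\<rho>(d := ?a)) (h(d := Suc (h ?a))) (D - {d})"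
      using F.forest_reparent[OF d fa da pendant] .
    show "sib E' W \<rho> a b \<and> a \<notin> {d} \<and> b \<notin> {d}" if "sib E' W (\<rho>(d := ?a)) a b" for a b
      using F.sib_reparent[OF d _ pendant that] F.full_adj(1)[OF fa] by auto
    fix qs assume q: "bad qs"
    then have "qs \<noteq> []" using k5 by auto
    then have "hd qs \<in> set qs" "last qs \<in> set qs" by auto
    then show "set qs \<inter> {d} \<noteq> {}" using has_d[OF q] by (cases "hd qs = d") auto
  next
    fix d' b assume d': "k = 5" "d' \<in> D - {d}" "{d', b} \<in> E'"
    then have "d' \<noteq> x" "d' \<noteq> y" using uniq[of d'] by auto
    then show "{d', b} \<in> E" using d' by (auto simp: doubleton_eq_iff)
  qed (use uniq in auto)
  then show ?thesis ..
qed

end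

section \<open>Joining siblings in two components with a missing root edge\<close>


locale sib_move2 = sib_move +
  fixes d1 d2 :: nat
  assumes root: "\<rho> x = r" and d1: "d1 \<in> D" and d2: "d2 \<in> D"
    and l1: "\<kappa> d1 = \<kappa> x" and l2: "\<kappa> d2 = \<kappa> y" and lxy: "\<kappa> x \<noteq> \<kappa> y"
begin

abbreviation bad_arms :: "nat list \<Rightarrow> nat list \<Rightarrow> bool" where
  "bad_arms L1 L2 \<equiv> arm x L1 \<and> arm y L2 \<and> length L1 + length L2 = k - 1"

abbreviation pendant :: "nat \<Rightarrow> bool" where
  "pendant d \<equiv> (\<forall>c c'. {d, c} \<in> E \<longrightarrow> {d, c'} \<in> E \<longrightarrow> c = c')"

lemma root_y: "\<rho> y = r"
  using root par_eq by simp

lemma swapped: "sib_move2 k n r E W \<rho> h D \<kappa> y x C d2 d1"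
proof -
  have "insert {y, x} E = E'" by (simp add: insert_commute)
  then show ?thesis
    using xW yW xy par_eq Ck Ck1 free root_y d1 d2 l1 l2 lxy
    by unfold_locales auto
qed

lemma d12: "d1 \<noteq> d2" using l1 l2 lxy by auto

lemma D_label: "d \<in> D \<Longrightarrow> \<kappa> d \<in> {\<kappa> x, \<kappa> y} \<Longrightarrow> d = d1 \<or> d = d2"
  using inj_onD[OF label_inj] d1 d2 l1 l2 by (metis insertE singletonD)

lemma arm_x: "arm x L \<Longrightarrow> a \<in> set L \<Longrightarrow> a \<in> W \<and> \<rho> a = r \<and> \<kappa> a = \<kappa> x \<and> (a \<in> D \<longrightarrow> a = d1) \<and> a \<noteq> d2"
  using arm_parent[OF _ xW] arm_label[OF _ xW root] root inj_onD[OF label_inj _ _ d1] l1 l2 lxy by metis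

lemma arm_y: "arm y L \<Longrightarrow> a \<in> set L \<Longrightarrow> a \<in> W \<and> \<rho> a = r \<and> \<kappa> a = \<kappa> y \<and> (a \<in> D \<longrightarrow> a = d2) \<and> a \<noteq> d1"
  using arm_parent[OF _ yW] arm_label[OF _ yW root_y] root_y inj_onD[OF label_inj _ _ d2] l1 l2 lxy by metis

lemma join:
  assumes "arm x L1" "arm y L2"
  shows "simple_path (sib E' W \<rho>) (rev L1 @ L2)"
proof -
  have up: "simple_path (sib E' W \<rho>) L" if "simple_path (sib E W \<rho>) L" for L
    by (rule simple_path_mono[OF that]) (simp add: sib'_iff)
  have "set L1 \<inter> set L2 = {}" using arm_x[OF assms(1)] arm_y[OF assms(2)] lxy by (metis disjoint_iff)
  moreover have "last (rev L1) = x" "hd L2 = y" using assms by (simp_all add: last_rev)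
  ultimately show ?thesis
    using up assms unfolding simple_path_append sib_path_rev by (simp add: sib'_iff)
qed

lemma ends_contra:
  assumes "arm x L1" "arm y L2"
    and "length L1 + length L2 = k - 1 \<or> k \<noteq> 5 \<and> length L1 + length L2 = k"
    and "last L1 \<noteq> d1" "last L2 \<noteq> d2"
  shows False
proof (rule no_real_ends[OF join[OF assms(1,2)]])
  show "hd (rev L1 @ L2) \<notin> D" using assms arm_x[OF assms(1), of "last L1"] by (auto simp: hd_rev)
  show "last (rev L1 @ L2) \<notin> D" using assms arm_y[OF assms(2), of "last L2"] by auto
qed (use assms(3) in simp)

lemma bad_arms_of:
  assumes "bad zs"
  obtains L1 L2 where "bad_arms L1 L2" "set zs = set L1 \<union> set L2"
proof -
  obtain L1 L2 where L: "arm x L1" "arm y L2" "zs = rev L1 @ L2 \<or> zs = rev L2 @ L1"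
    using bad_decomp[OF assms] by metis
  have "length zs = length L1 + length L2" "set zs = set L1 \<union> set L2" using L(3) by auto
  then show ?thesis using that[of L1 L2] L assms by auto
qed

section \<open>Rerouting and extending arms\<close>

lemma nbr_arm:
  assumes "d \<in> D"
  obtains a where "sib E W \<rho> d a" "a \<noteq> d" "a \<notin> D"
proof -
  obtain a where a: "a \<in> W" "{d, a} \<in> E" using D_nbr[OF assms] by blast
  then show ?thesis using that[of a] nbr_of_D[OF assms a(2)] edge_neq[OF a(2)] by auto
qed

lemma arm_two:
  assumes "d \<in> D" "d \<in> W"
  obtains a where "arm d [d, a]" "a \<noteq> d"
  using nbr_arm[OF assms(1)] by (metis list.distinct(1) list.sel(1) list.set(1,2) simple_path_Cons simple_path_Nil empty_iff singletonD set_ConsD)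

text \<open>Rotation in the sense of Posa: the chord from the end \<open>d\<close> to
  \<open>c\<close> allows reversing everything behind \<open>c\<close>. The new end is the old
  successor of \<open>c\<close>, which differs from \<open>d\<close> because \<open>c\<close> is not
  the predecessor of \<open>d\<close>.\<close>

lemma arm_reroute:
  assumes L: "arm z L" "last L = d" and c: "sib E W \<rho> d c" "c \<noteq> d" "c \<noteq> last (butlast L)" "c \<in> set L"
  obtains L' where "arm z L'" "length L' = length L" "last L' \<noteq> d"
proof -
  obtain M where M: "L = M @ [d]" using L by (metis append_butlast_last_id)
  have cM: "c \<in> set M" using c M by auto
  then obtain us vs where uv: "M = us @ c # vs" by (metis split_list)
  have "butlast L = M" using M by simp
  then have vne: "vs \<noteq> []" using c(3) uv by auto
  have sp: "simple_path (sib E W \<rho>) (us @ c # vs @ [d])" using L(1) M uv by simp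
  then have p: "simple_path (sib E W \<rho>) us" "simple_path (sib E W \<rho>) (c # vs @ [d])"
      "set us \<inter> set (c # vs @ [d]) = {}" "us = [] \<or> sib E W \<rho> (last us) c"
    unfolding simple_path_append[of _ us] by auto
  then have q: "simple_path (sib E W \<rho>) (vs @ [d])" "c \<notin> set (vs @ [d])"
    unfolding simple_path_Cons by auto
  have "simple_path (sib E W \<rho>) (rev (vs @ [d]))" using q(1) by (simp only: sib_path_rev)
  then have "simple_path (sib E W \<rho>) (c # rev (vs @ [d]))"
    using q(2) sib_sym[OF c(1)] by (subst simple_path_Cons) auto
  moreover have "set us \<inter> set (c # rev (vs @ [d])) = {}" using p(3) by auto
  ultimately have "simple_path (sib E W \<rho>) (us @ c # rev (vs @ [d]))"
    using p(1,4) simple_path_append[of _ us] by simp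
  moreover have "hd (us @ c # rev (vs @ [d])) = z" using L(1) M uv by (cases us) auto
  moreover have "last (us @ c # rev (vs @ [d])) = hd vs" using vne by (simp add: last_rev)
  moreover have "hd vs \<noteq> d" using q(1) vne by (cases vs) (auto simp: simple_path_def)
  ultimately show ?thesis using M uv by (intro that[of "us @ c # rev (vs @ [d])"]) auto
qed

lemma arm_extend:
  assumes L: "arm z L" "last L = d" and c: "sib E W \<rho> d c" "c \<notin> set L"
  shows "arm z (L @ [c])"
  using assms by (auto simp: simple_path_append simple_path_Cons)

text \<open>Of two neighbours at least one differs from any prescribed \<open>b\<close>, which will
  be the predecessor of \<open>d\<close> on an arm. The conclusion k \<noteq> 5 comes from
  \<open>five\<close> and makes the cycle of length k + 1 available.\<close>

lemma not_pendantE: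
  assumes "\<not> pendant d" "d \<in> D"
  obtains c where "sib E W \<rho> d c" "c \<noteq> d" "c \<noteq> b" "k \<noteq> 5"
proof -
  obtain c c' where cc: "{d, c} \<in> E" "{d, c'} \<in> E" "c \<noteq> c'" using assms(1) by blast
  then have "k \<noteq> 5" using five[OF _ assms(2)] by blast
  then show ?thesis
    using that[of c] that[of c'] cc nbr_of_D(1)[OF assms(2)] edge_neq[OF cc(1)] edge_neq[OF cc(2)] by metis
qed

lemma nbr_five:
  assumes "\<And>d. d \<in> D' \<Longrightarrow> d \<in> D \<and> d \<noteq> x \<and> d \<noteq> y \<and> d \<noteq> d'" "d \<in> D'" "{d, b} \<in> insert {r, d'} E'"
  shows "{d, b} \<in> E"
  using assms(1)[OF assms(2)] assms(3) D rW by (auto simp: doubleton_eq_iff)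

text \<open>After the root edge of \<open>d1\<close>, the merged component keeps \<open>d2\<close>
  as its only vertex in \<open>D\<close>. For k = 5 it has to remain pendant, so it must not be an
  end of the new edge.\<close>

lemma Good_play:
  assumes none: "\<And>L1 L2. \<not> bad_arms L1 L2" and ok: "k = 5 \<Longrightarrow> d2 \<noteq> y"
  shows "Good k n (insert {r, d1} E')"
proof (rule GoodI[where X = "{}"])
  show "forest k n r (insert {r, d1} E') W \<rho> h (D - {d1})" by (rule F.forest_root_edge[OF d1])
  show "set zs \<inter> {} \<noteq> {}" if "bad zs" for zs using bad_arms_of[OF that] none by metis
  fix d b assume d: "k = 5" "d \<in> D - {d1}" "{d, b} \<in> insert {r, d1} E'"
  have "d \<noteq> x" "d \<noteq> y" using D_label[of d] d ok d12 l2 lxy by auto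
  then show "{d, b} \<in> E" using nbr_five[of "{d}" d1 d b] d by auto
qed (use F.sib_root_edge[of d1] D_label in auto)

text \<open>Dropping the end \<open>d1\<close> from a bad path leaves k - 2 vertices beginning with
  its neighbour. All of them see the root, provided that \<open>d2\<close> is not among them or has
  received its root edge.\<close>

lemma full_penultimate:
  assumes L: "bad_arms L1 L2" "last L1 = d1" "x \<noteq> d1" and E'': "E' \<subseteq> E''"
    and d2: "d2 \<in> set L2 \<Longrightarrow> {r, d2} \<in> E''"
  shows "full E'' W \<rho> k (last (butlast L1))" "{d1, last (butlast L1)} \<in> E"
proof -
  let ?b = "last (butlast L1)" and ?ys = "rev (butlast L1) @ L2"
  have split: "L1 = butlast L1 @ [d1]" using L by (metis append_butlast_last_id)
  have bne: "butlast L1 \<noteq> []" using split L by (metis append_Nil list.sel(1))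
  have j: "simple_path (sib E' W \<rho>) (d1 # ?ys)" using join[of L1 L2] L split
    by (metis append_Cons append_Nil rev.simps(2) rev_append rev_rev_ident append_assoc rev_singleton_conv)
  then have d1n: "d1 \<notin> set ?ys" and p: "simple_path (sib E' W \<rho>) ?ys" unfolding simple_path_Cons by auto
  have "simple_path (sib E W \<rho>) (butlast L1 @ [d1])" using L split by simp
  then have "sib E W \<rho> ?b d1" using bne unfolding simple_path_append by auto
  then show "{d1, ?b} \<in> E" by (simp add: sib_def insert_commute)
  have mem: "a \<in> W \<and> \<rho> a = r \<and> {a, r} \<in> E''" if a: "a \<in> set ?ys" for a
  proof -
    have "a \<in> set L1 \<or> a \<in> set L2" using a in_set_butlastD by fastforce
    then have aW: "a \<in> W \<and> \<rho> a = r \<and> (a \<in> D \<longrightarrow> a = d2)"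
      using arm_x[of L1 a] arm_y[of L2 a] L(1) a d1n by metis
    show ?thesis
    proof (cases "a \<in> D")
      case True
      then have "a = d2" using aW by simp
      moreover have "d2 \<in> set L2" using a calculation arm_x[of L1 d2] L(1) in_set_butlastD by fastforce
      ultimately show ?thesis using d2 aW by (simp add: insert_commute)
    next
      case False
      then show ?thesis using F.up[of a] aW E'' by auto
    qed
  qed
  have "hd ?ys = ?b" using bne by (simp add: hd_rev)
  moreover have "?b \<in> set ?ys" using bne by simp
  moreover have "length ?ys = k - 2" using L(1) by (cases L1) auto
  moreover have "simple_path (sib E'' W \<rho>) ?ys"
    by (rule simple_path_mono[OF p]) (use E'' in \<open>auto simp: sib_def\<close>)
  ultimately show "full E'' W \<rho> k ?b" using mem unfolding full_def full_path_def by metis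
qed

text \<open>One move settles two debts: \<open>d2\<close> gets its root edge and \<open>d1\<close>
  moves below its full neighbour. By \<open>ends_contra\<close> and \<open>other\<close>, every bad
  path has \<open>d1\<close> as an end, so none survives in the block.\<close>

lemma Good_reparent_play:
  assumes L: "bad_arms L1 L2" "last L1 = d1" "x \<noteq> d1" and pend: "pendant d1"
    and other: "\<And>M1 M2. bad_arms M1 M2 \<Longrightarrow> last M2 = d2 \<Longrightarrow> last M1 = d1"
  shows "Good k n (insert {r, d2} E')"
proof -
  let ?E = "insert {r, d2} E'" and ?b = "last (butlast L1)"
  interpret G: forest k n r ?E W \<rho> h "D - {d2}" by (rule F.forest_root_edge[OF d2])
  have b: "full ?E W \<rho> k ?b" "{d1, ?b} \<in> E" using full_penultimate[OF L, of ?E] by auto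
  have d1y: "d1 \<noteq> y" using l1 lxy by auto
  have d1r: "d1 \<noteq> r" using d1 D rW by auto
  have pend': "b' = ?b" if "{d1, b'} \<in> ?E" for b'
  proof -
    have "{d1, b'} \<in> E" using that L(3) d1y d1r d12 by (auto simp: doubleton_eq_iff)
    then show ?thesis using pend b(2) by blast
  qed
  have d1': "d1 \<in> D - {d2}" using d1 d12 by auto
  show ?thesis
  proof (rule GoodI[where X = "{d1}"])
    show "forest k n r ?E W (\<rho>(d1 := ?b)) (h(d1 := Suc (h ?b))) (D - {d2} - {d1})"
      using G.forest_reparent[OF d1' b(1) _ pend'] b(2) by auto
    show "sib E' W \<rho> u v \<and> u \<notin> {d1} \<and> v \<notin> {d1}" if "sib ?E W (\<rho>(d1 := ?b)) u v" for u v
      using G.sib_reparent[OF d1' _ pend' that] G.full_adj(1)[OF b(1)] F.sib_root_edge[of d2] by auto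
    fix zs assume "bad zs"
    then obtain M1 M2 where M: "bad_arms M1 M2" "set zs = set M1 \<union> set M2" using bad_arms_of by metis
    have "last M1 = d1" using ends_contra[of M1 M2] other[of M1 M2] M(1) by blast
    moreover have "last M1 \<in> set M1" using M(1) by auto
    ultimately show "set zs \<inter> {d1} \<noteq> {}" using M(2) by auto
  next
    fix d b assume d: "k = 5" "d \<in> D - {d2} - {d1}" "{d, b} \<in> ?E"
    then have "d \<noteq> x" "d \<noteq> y" using D_label[of d] by auto
    then show "{d, b} \<in> E" using nbr_five[of "{d}" d2 d b] d by auto
  qed (use D_label in auto)
qed

text \<open>A pendant vertex that does not start an arm cannot be inner to it. So \<open>d2\<close>
  is off the first bad path and \<open>d1\<close> off the second, both neighbours are full already
  without a root edge, and both debts are cleared without a move.\<close>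

lemma Good_reparent_both:
  assumes L: "bad_arms L1 L2" "last L1 = d1" "last L2 \<noteq> d2"
    and M: "bad_arms M1 M2" "last M1 \<noteq> d1" "last M2 = d2"
    and ne: "x \<noteq> d1" "y \<noteq> d2" and pend: "pendant d1" "pendant d2"
  shows "Good k n E'"
proof -
  interpret sw: sib_move2 k n r E W \<rho> h D \<kappa> y x C d2 d1 by (rule swapped)
  let ?a = "last (butlast L1)" and ?b = "last (butlast M2)"
  have E'eq: "insert {y, x} E = E'" by (simp add: insert_commute)
  have inner: False if i: "arm z N" "d \<in> set N" "d \<noteq> z" "d \<noteq> last N" "pendant d" for z N d
  proof -
    obtain a b where "a \<noteq> b" "sib E W \<rho> a d" "sib E W \<rho> d b"
      using neighbours_of_inner[of "sib E W \<rho>" N d] i(1-4) by metis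
    then show False using i(5) unfolding sib_def by (metis insert_commute)
  qed
  have a: "full E' W \<rho> k ?a" "{d1, ?a} \<in> E"
    using full_penultimate[OF L(1,2) ne(1), of E'] inner[of L2 y d2] L ne pend by auto
  have M': "sw.bad_arms M2 M1" using M(1) by simp
  have b: "full E' W \<rho> k ?b" "{d2, ?b} \<in> E"
    using sw.full_penultimate[OF M' M(3) ne(2), of E'] inner[of M1 x d1] M ne pend E'eq by auto
  have neq: "d1 \<noteq> y" "d2 \<noteq> x" "d1 \<noteq> r" "d2 \<noteq> r" using l1 l2 lxy d1 d2 D rW by auto
  have pa: "c = ?a" if "{d1, c} \<in> E'" for c
    using that ne neq pend(1) a(2) by (auto simp: doubleton_eq_iff)
  have pb: "c = ?b" if "{d2, c} \<in> E'" for c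
    using that ne neq pend(2) b(2) by (auto simp: doubleton_eq_iff)
  interpret G: forest k n r E' W "\<rho>(d1 := ?a)" "h(d1 := Suc (h ?a))" "D - {d1}"
    using F.forest_reparent[OF d1 a(1) _ pa] a(2) by auto
  have d2': "d2 \<in> D - {d1}" using d2 d12 by auto
  \<comment> \<open>Moving \<open>d1\<close> does not spoil this fullness: \<open>d1\<close> does
    not see the root and so lies on no full path there.\<close>
  have b': "full E' W (\<rho>(d1 := ?a)) k ?b"
  proof (rule full_mono[OF b(1)])
    fix c assume c: "c \<in> W" "\<rho> c = \<rho> ?b" "{c, \<rho> ?b} \<in> E'"
    then have "c \<noteq> d1" using F.D_nonadj[OF d1] D_parent[OF d1] by metis
    then show "c \<in> W \<and> (\<rho>(d1 := ?a)) c = \<rho> c" using c by simp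
  qed (use k5 in auto)
  show ?thesis
  proof (rule GoodI[where X = "{d1, d2}"])
    show "forest k n r E' W (\<rho>(d1 := ?a, d2 := ?b))
        ((h(d1 := Suc (h ?a)))(d2 := Suc ((h(d1 := Suc (h ?a))) ?b))) (D - {d1} - {d2})"
      using G.forest_reparent[OF d2' b' _ pb] b(2) by auto
    fix u v assume s: "sib E' W (\<rho>(d1 := ?a, d2 := ?b)) u v"
    have s': "sib E' W (\<rho>(d1 := ?a)) u v" "u \<noteq> d2" "v \<noteq> d2"
      using G.sib_reparent[OF d2' _ pb s] G.full_adj(1)[OF b'] by auto
    then show "sib E' W \<rho> u v \<and> u \<notin> {d1, d2} \<and> v \<notin> {d1, d2}"
      using F.sib_reparent[OF d1 _ pa s'(1)] F.full_adj(1)[OF a(1)] by auto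
  next
    fix zs assume "bad zs"
    then obtain N1 N2 where N: "bad_arms N1 N2" "set zs = set N1 \<union> set N2" using bad_arms_of by metis
    have "last N1 = d1 \<or> last N2 = d2" using ends_contra[of N1 N2] N(1) by blast
    moreover have "last N1 \<in> set N1" "last N2 \<in> set N2" using N(1) by auto
    ultimately show "set zs \<inter> {d1, d2} \<noteq> {}" using N(2) by auto
  next
    fix d b assume d: "k = 5" "d \<in> D - {d1} - {d2}" "{d, b} \<in> E'"
    then have "d \<noteq> x" "d \<noteq> y" using D_label[of d] by auto
    then show "{d, b} \<in> E" using d by (auto simp: doubleton_eq_iff)
  qed (use D_label in auto)
qed

text \<open>A second neighbour of \<open>d1\<close> on the arm allows a rotation to an end outside
  \<open>D\<close> and hence a cycle of length k. A second neighbour off the arm extends it, which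
  gives a cycle of length k + 1; for k = 5 there is no second neighbour by
  \<open>five\<close>.\<close>

lemma pendant_one_end:
  assumes L: "bad_arms L1 L2" "last L1 = d1" "last L2 \<noteq> d2"
  shows "pendant d1"
proof (rule ccontr)
  assume "\<not> pendant d1"
  then obtain c where c: "sib E W \<rho> d1 c" "c \<noteq> d1" "c \<noteq> last (butlast L1)" "k \<noteq> 5"
    using not_pendantE d1 by metis
  show False
  proof (cases "c \<in> set L1")
    case True
    obtain L' where L': "arm x L'" "length L' = length L1" "last L' \<noteq> d1"
      using arm_reroute[OF _ L(2) c(1-3) True, where z = x] L(1) by blast
    then show False using ends_contra[of L' L2] L by simp
  next
    case False
    have "arm x (L1 @ [c])" using arm_extend[OF _ L(2) c(1) False, where z = x] L(1) by blast
    then show False using ends_contra[of "L1 @ [c]" L2] L c k5 by simp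
  qed
qed

lemma butlast_arm:
  assumes "arm z L" "2 \<le> length L"
  shows "arm z (butlast L)" "last (butlast L) \<noteq> last L"
proof -
  have split: "L = butlast L @ [last L]" using assms by simp
  have ne: "butlast L \<noteq> []" using assms(2) by (cases L rule: rev_cases) auto
  have "simple_path (sib E W \<rho>) (butlast L)" using assms(1) split simple_path_append by metis
  moreover have "hd (butlast L) = z" using assms(1) ne split by (metis hd_append2)
  ultimately show "arm z (butlast L)" using ne by blast
  have "distinct (butlast L @ [last L])" using assms(1) split by (simp add: simple_path_def)
  then show "last (butlast L) \<noteq> last L" using last_in_set[OF ne] by auto
qed

lemma arm_length2: "arm z L \<Longrightarrow> last L \<noteq> z \<Longrightarrow> 2 \<le> length L"
  by (cases L; cases "tl L") auto

text \<open>If neither were pendant, either both arms could be rotated, or one could be extended by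
  a vertex and the other shortened by one. The total stays k - 1 and both ends leave
  \<open>D\<close>, which closes a cycle of length k.\<close>

lemma pendant_both_ends:
  assumes L: "bad_arms L1 L2" "last L1 = d1" "last L2 = d2" and ne: "x \<noteq> d1" "y \<noteq> d2"
  shows "pendant d1 \<or> pendant d2"
proof (rule ccontr)
  assume "\<not> (pendant d1 \<or> pendant d2)"
  then obtain c c' where c: "sib E W \<rho> d1 c" "c \<noteq> d1" "c \<noteq> last (butlast L1)"
      and c': "sib E W \<rho> d2 c'" "c' \<noteq> d2" "c' \<noteq> last (butlast L2)"
    using not_pendantE d1 d2 by metis
  have len: "2 \<le> length L1" "2 \<le> length L2" using arm_length2[of L1 x] arm_length2[of L2 y] L ne by auto
  have sum: "length L1 + length L2 = k - 1" using L by blast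
  show False
  proof (cases "c \<in> set L1 \<and> c' \<in> set L2")
    case True
    obtain L1' where L1': "arm x L1'" "length L1' = length L1" "last L1' \<noteq> d1"
      using arm_reroute[OF _ L(2) c, where z = x] True L(1) by blast
    obtain L2' where L2': "arm y L2'" "length L2' = length L2" "last L2' \<noteq> d2"
      using arm_reroute[OF _ L(3) c', where z = y] True L(1) by blast
    show False using ends_contra[of L1' L2'] L1' L2' L(1) by simp
  next
    case False
    then consider "c \<notin> set L1" | "c' \<notin> set L2" by blast
    then show False
    proof cases
      case 1
      have "arm x (L1 @ [c])" using arm_extend[OF _ L(2) c(1) 1, where z = x] L(1) by blast
      moreover have "arm y (butlast L2)" "last (butlast L2) \<noteq> d2"
        using butlast_arm[of L2 y] L len by auto
      moreover have "length (L1 @ [c]) + length (butlast L2) = k - 1" using len sum by simp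
      ultimately show False using ends_contra[of "L1 @ [c]" "butlast L2"] c by simp
    next
      case 2
      have "arm y (L2 @ [c'])" using arm_extend[OF _ L(3) c'(1) 2, where z = y] L(1) by blast
      moreover have "arm x (butlast L1)" "last (butlast L1) \<noteq> d1"
        using butlast_arm[of L1 x] L len by auto
      moreover have "length (butlast L1) + length (L2 @ [c']) = k - 1" using len sum by simp
      ultimately show False using ends_contra[of "butlast L1" "L2 @ [c']"] c' by simp
    qed
  qed
qed

section \<open>Cases by how many of \<open>d1\<close>, \<open>d2\<close> are ends of the new
  edge\<close>

lemma singleton_arm: "arm z L \<Longrightarrow> last L = z \<Longrightarrow> L = [z]"
  by (cases L; cases "tl L" rule: rev_cases) (auto simp: simple_path_def)

text \<open>An arm ending in \<open>d1\<close> is just \<open>[d1]\<close>, and lengthening it by a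
  neighbour closes a cycle of length k + 1; likewise for \<open>d2\<close>. So no bad path exists.
  For k = 5 the path from a through \<open>d1\<close> and \<open>d2\<close> to b already closes a
  cycle of length 5, so this case cannot occur.\<close>

lemma Good_both_touched:
  assumes "x = d1" "y = d2"
  shows "Good k n (insert {r, d1} E')"
proof (rule Good_play)
  obtain a where a: "arm x [d1, a]" "a \<noteq> d1" using arm_two[OF d1] d1 D assms by auto
  obtain b where b: "arm y [d2, b]" "b \<noteq> d2" using arm_two[OF d2] d2 D assms by auto
  show k6: "d2 \<noteq> y" if "k = 5" using ends_contra[of "[d1, a]" "[d2, b]"] a b that by auto
  fix L1 L2
  show "\<not> bad_arms L1 L2"
  proof
    assume L: "bad_arms L1 L2"
    have k: "k \<noteq> 5" using k6 assms by auto
    consider "last L1 \<noteq> d1" "last L2 \<noteq> d2" | "last L1 = d1" | "last L2 = d2" by blast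
    then show False
    proof cases
      case 1
      then show False using ends_contra[of L1 L2] L by blast
    next
      case 2
      then have L1: "L1 = [d1]" using singleton_arm[of L1 x] L assms by simp
      have "last L2 \<noteq> d2"
      proof
        assume "last L2 = d2"
        then have "L2 = [y]" using singleton_arm[of L2 y] L assms by simp
        then have "length L1 + length L2 = 2" using L1 by simp
        then show False using L k5 by linarith
      qed
      then show False using ends_contra[of "[d1, a]" L2] L1 L a k k5 by auto
    next
      case 3
      then have L2: "L2 = [d2]" using singleton_arm[of L2 y] L assms by simp
      have "last L1 \<noteq> d1"
      proof
        assume "last L1 = d1"
        then have "L1 = [x]" using singleton_arm[of L1 x] L assms by simp
        then have "length L1 + length L2 = 2" using L2 by simp
        then show False using L k5 by linarith
      qed
      then show False using ends_contra[of L1 "[d2, b]"] L2 L b k k5 by auto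
    qed
  qed
qed

text \<open>Every bad path turns out to end in \<open>d2\<close>, and \<open>d2\<close> to be
  pendant. So \<open>d2\<close> is moved below its neighbour, while the reply pays for
  \<open>d1\<close>, which has become an end of the new edge.\<close>

lemma Good_one_touched:
  assumes x: "x = d1" and y: "y \<noteq> d2"
  shows "Good k n (insert {r, d1} E')"
proof -
  interpret sw: sib_move2 k n r E W \<rho> h D \<kappa> y x C d2 d1 by (rule swapped)
  have E'eq: "insert {y, x} E = E'" by (simp add: insert_commute)
  obtain a where a: "arm x [d1, a]" "a \<noteq> d1" using arm_two[OF d1] d1 D x by auto
  have end2: "last L2 = d2" if L: "bad_arms L1 L2" for L1 L2
  proof (rule ccontr)
    assume n: "last L2 \<noteq> d2"
    then have "last L1 = d1" using ends_contra[of L1 L2] L by blast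
    then have L1: "L1 = [d1]" using singleton_arm[of L1 x] L x by simp
    moreover have "length L1 + length L2 = k - 1" using L by blast
    ultimately have len: "length L2 = k - 2" by simp
    show False
    proof (cases "k = 5")
      case False
      then show False using ends_contra[of "[d1, a]" L2] n L1 L a k5 by auto
    next
      \<comment> \<open>Only the cycle of length 5 is at hand, so the extension by \<open>a\<close>
        is balanced by dropping the last vertex of \<open>L2\<close>. If this exposes
        \<open>d2\<close>, then \<open>d2\<close> was an inner vertex with two neighbours, against
        \<open>five\<close>.\<close>
      case True
      have "2 \<le> length L2" using len True by simp
      then have bl: "arm y (butlast L2)" using butlast_arm[of L2 y] L by auto
      show False
      proof (cases "last (butlast L2) = d2")
        case False
        then show False using ends_contra[of "[d1, a]" "butlast L2"] bl len a True by auto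
      next
        case d2_last: True
        have "butlast L2 \<noteq> []" using bl by blast
        then have "d2 \<in> set L2" using d2_last in_set_butlastD[OF last_in_set] by metis
        then obtain p q where "p \<noteq> q" "sib E W \<rho> p d2" "sib E W \<rho> d2 q"
          using neighbours_of_inner[of "sib E W \<rho>" L2 d2] L n y by metis
        then show False using five[OF True d2] unfolding sib_def by (metis insert_commute)
      qed
    qed
  qed
  show ?thesis
  proof (cases "\<exists>L1 L2. bad_arms L1 L2")
    case False
    then show ?thesis using y by (intro Good_play) auto
  next
    case True
    then obtain L1 L2 where L: "bad_arms L1 L2" by blast
    note l = end2[OF L]
    have len2: "2 \<le> length L2" using arm_length2[of L2 y] L l y by auto
    have "pendant d2"
    proof (rule ccontr)
      assume "\<not> pendant d2"
      then obtain c where c: "sib E W \<rho> d2 c" "c \<noteq> d2" "c \<noteq> last (butlast L2)" "k \<noteq> 5"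
        using not_pendantE d2 by metis
      obtain L1' where L1': "arm x L1'" "last L1' \<noteq> d1" "length L1' = length L1 \<or> L1 = [d1] \<and> length L1' = 2"
      proof (cases "last L1 = d1")
        case True
        then show ?thesis using that[of "[d1, a]"] a singleton_arm[of L1 x] L x by auto
      next
        case False
        then show ?thesis using that[of L1] L by auto
      qed
      show False
      proof (cases "c \<in> set L2")
        case True
        obtain L2' where L2': "arm y L2'" "length L2' = length L2" "last L2' \<noteq> d2"
          using arm_reroute[OF _ l c(1-3) True, where z = y] L by blast
        then show False using ends_contra[of L1' L2'] L1' L c(4) k5 by auto
      next
        case False
        have e: "arm y (L2 @ [c])" using arm_extend[OF _ l c(1) False, where z = y] L by blast
        show False
        \<comment> \<open>If \<open>L1\<close> is the single vertex \<open>d1\<close>, the extended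
          arm alone has k - 1 vertices and violates the old bound. Otherwise \<open>L1\<close> does
          not end in \<open>d1\<close>, and the cycle of length k + 1 gives the
          contradiction.\<close>
        proof (cases "L1 = [d1]")
          case True
          then show False using short[of "L2 @ [c]"] e L by auto
        next
          case False
          then show False using ends_contra[of L1' "L2 @ [c]"] L1' e L c(2,4) k5 by auto
        qed
      qed
    qed
    moreover have "sw.bad_arms L2 L1" using L by simp
    moreover have "last M1 = d2" if "sw.bad_arms M1 M2" for M1 M2 using end2[of M2 M1] that by simp
    ultimately have "Good k n (insert {r, d1} (insert {y, x} E))" using sw.Good_reparent_play l y by blast
    then show ?thesis using E'eq by simp
  qed
qed

text \<open>\<open>?F1\<close> and \<open>?F2\<close> ask for bad paths with exactly one of
  \<open>d1\<close>, \<open>d2\<close> as an end. If both occur, both vertices are pendant and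
  moved; if one occurs, that vertex is moved and the other gets its root edge. If neither occurs,
  any bad path ends in both, and whichever is pendant is moved.\<close>

lemma Good_untouched:
  assumes ne: "x \<noteq> d1" "y \<noteq> d2"
  shows "Good k n E' \<or> Good k n (insert {r, d1} E') \<or> Good k n (insert {r, d2} E')"
proof -
  interpret sw: sib_move2 k n r E W \<rho> h D \<kappa> y x C d2 d1 by (rule swapped)
  have E'eq: "insert {y, x} E = E'" by (simp add: insert_commute)
  have swb: "sw.bad_arms M N \<longleftrightarrow> bad_arms N M" for M N by auto
  have play2: "Good k n (insert {r, d2} E')"
    if "bad_arms L1 L2" "last L1 = d1" "pendant d1"
      "\<And>M1 M2. bad_arms M1 M2 \<Longrightarrow> last M2 = d2 \<Longrightarrow> last M1 = d1" for L1 L2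
    using Good_reparent_play[OF that(1,2) ne(1) that(3)] that(4) by blast
  have play1: "Good k n (insert {r, d1} E')"
    if "bad_arms L1 L2" "last L2 = d2" "pendant d2"
      "\<And>M1 M2. bad_arms M1 M2 \<Longrightarrow> last M1 = d1 \<Longrightarrow> last M2 = d2" for L1 L2
    using sw.Good_reparent_play[of L2 L1] that ne(2) unfolding swb E'eq by blast
  let ?F1 = "\<exists>L1 L2. bad_arms L1 L2 \<and> last L1 = d1 \<and> last L2 \<noteq> d2"
  let ?F2 = "\<exists>L1 L2. bad_arms L1 L2 \<and> last L1 \<noteq> d1 \<and> last L2 = d2"
  have p1: "pendant d1" if ?F1 using that pendant_one_end by blast
  have p2: "pendant d2" if ?F2 using that sw.pendant_one_end unfolding swb by blast
  consider "?F1" "?F2" | "?F1" "\<not> ?F2" | "\<not> ?F1" "?F2" | "\<not> ?F1" "\<not> ?F2" by blast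
  then show ?thesis
  proof cases
    case 1
    then show ?thesis using Good_reparent_both ne p1[OF 1(1)] p2[OF 1(2)] by blast
  next
    case 2
    then show ?thesis using play2 p1[OF 2(1)] by blast
  next
    case 3
    then show ?thesis using play1 p2[OF 3(2)] by blast
  next
    case 4
    show ?thesis
    proof (cases "\<exists>L1 L2. bad_arms L1 L2")
      case False
      then show ?thesis using Good_play ne by blast
    next
      case True
      then obtain L1 L2 where L: "bad_arms L1 L2" by blast
      have "last L1 = d1" "last L2 = d2" using ends_contra[of L1 L2] L 4 by blast+
      then show ?thesis using pendant_both_ends[OF L _ _ ne] play1[OF L] play2[OF L] 4 by blast
    qed
  qed
qed

end

section \<open>The strategy of Mini\<close>


text \<open>The first alternative means that the move of Max did no harm; Mini then still has to
  move, which \<open>free_step\<close> takes care of.\<close>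

definition reply :: "nat \<Rightarrow> nat \<Rightarrow> nat set set \<Rightarrow> bool" where
  "reply k n E \<longleftrightarrow> Good k n E \<or> (\<exists>f\<in>all_edges {..<n} - E. Good k n (insert f E))"

lemma pair_in_all_edges: "{a, b} \<in> all_edges V \<longleftrightarrow> a \<in> V \<and> b \<in> V \<and> a \<noteq> b"
  by (auto simp: all_edges_def card_insert_if)

lemma good_empty:
  assumes "5 \<le> k" "1 \<le> n"
  shows "Good k n {}"
proof -
  have "good k n 0 {} {} id (\<lambda>_. 0) {} id"
  proof (intro good.intro good_axioms.intro forest.intro)
    fix xs :: "nat list" assume xs: "simple_path (sib {} {} id) xs"
    have "length xs < 2"
      using simple_path_nth[OF xs, of 0] by (cases "length xs < 2") (auto simp: sib_def)
    then show "length xs < k - 1" using assms by simp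
  qed (use assms in \<open>auto simp: sib_def\<close>)
  then show ?thesis unfolding Good_def by blast
qed

lemma Good_free:
  assumes G: "Good k n E" and C: "dense_family k C"
  shows "free_of C ({..<n}, E)"
proof (rule ccontr)
  assume "\<not> free_of C ({..<n}, E)"
  moreover have "cycle_family C" and short: "\<forall>l<k. cycle_graph l \<notin> C" using C by (auto simp: dense_family_def)
  ultimately obtain xs where xs: "cyc E xs" "cycle_graph (length xs) \<in> C" using not_free_cyc by blast
  obtain r W \<rho> h D \<kappa> where "good k n r E W \<rho> h D \<kappa>" using G unfolding Good_def by blast
  then have "length xs < k" using good.cyc_short xs(1) by blast
  then show False using short xs(2) by blast
qed

lemma Good_card:
  assumes "Good k n E"
  shows "2 * card E \<le> (k - 1) * (n - 1)" "finite E"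
proof -
  obtain r W \<rho> h D \<kappa> where g: "good k n r E W \<rho> h D \<kappa>" using assms unfolding Good_def by blast
  interpret good k n r E W \<rho> h D \<kappa> by (rule g)
  have "card W \<le> card ({..<n} - {r})" using W by (intro card_mono) auto
  also have "\<dots> = n - 1" using r by simp
  finally have "(k - 1) * card W \<le> (k - 1) * (n - 1)" by simp
  then show "2 * card E \<le> (k - 1) * (n - 1)" using edge_count by linarith
  show "finite E" using edges_subset finite_all_edges finite_subset by blast
qed

context good
begin

lemma vertex_less: "a \<in> insert r W \<Longrightarrow> a < n"
  using W r by auto

lemma root_edge_new:
  assumes "d \<in> D"
  shows "{r, d} \<in> all_edges {..<n} - E"
  using assms D_nonadj[OF assms] D rW vertex_less[of r] vertex_less[of d]
  by (auto simp: pair_in_all_edges insert_commute)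

lemma sib_step:
  assumes xy: "x \<in> W" "y \<in> W" "x \<noteq> y" "\<rho> x = \<rho> y" and C: "dense_family k C"
    and free: "free_of C ({..<n}, insert {x, y} E)"
  shows "reply k n (insert {x, y} E)"
proof -
  interpret sib_move k n r E W \<rho> h D \<kappa> x y C
    using xy free C k5 by unfold_locales (auto simp: dense_family_def)
  have new: "{r, d} \<in> all_edges {..<n} - E'" if "d \<in> D" for d
    using root_edge_new[OF that] xW yW rW by (auto simp: doubleton_eq_iff)
  show ?thesis
  proof (cases "\<rho> x = r \<and> (\<exists>d\<in>D. \<kappa> d \<in> {\<kappa> x, \<kappa> y})")
    case False
    then have "Good k n E'" using Good_no_D by blast
    then show ?thesis unfolding reply_def by blast
  next
    case True
    then obtain d where root: "\<rho> x = r" and d: "d \<in> D" "\<kappa> d \<in> {\<kappa> x, \<kappa> y}" by blast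
    show ?thesis
    proof (cases "\<exists>d'\<in>D. \<kappa> d' \<in> {\<kappa> x, \<kappa> y} \<and> d' \<noteq> d")
      case False
      then have "Good k n E' \<or> Good k n (insert {r, d} E')" using Good_one_D[OF root d(1)] by blast
      then show ?thesis using new[OF d(1)] unfolding reply_def by blast
    next
      case True
      then obtain d' where d': "d' \<in> D" "\<kappa> d' \<in> {\<kappa> x, \<kappa> y}" "d' \<noteq> d" by blast
      then have ne: "\<kappa> d \<noteq> \<kappa> d'" using inj_onD[OF label_inj] d by blast
      obtain d1 d2 where dd: "d1 \<in> D" "d2 \<in> D" "\<kappa> d1 = \<kappa> x" "\<kappa> d2 = \<kappa> y" "\<kappa> x \<noteq> \<kappa> y"
        using d d' ne by auto
      interpret S: sib_move2 k n r E W \<rho> h D \<kappa> x y C d1 d2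
        using dd root by unfold_locales
      interpret S': sib_move2 k n r E W \<rho> h D \<kappa> y x C d2 d1
        by (rule S.swapped)
      have E'eq: "insert {y, x} E = E'" by (simp add: insert_commute)
      have "Good k n E' \<or> Good k n (insert {r, d1} E') \<or> Good k n (insert {r, d2} E')"
        using S.Good_both_touched S.Good_one_touched S'.Good_one_touched S.Good_untouched
        unfolding E'eq by blast
      then show ?thesis using new[OF dd(1)] new[OF dd(2)] unfolding reply_def by blast
    qed
  qed
qed

lemma leaf_step:
  assumes z: "z \<notin> insert r W" "z < n" and u: "u \<in> insert r W"
  shows "reply k n (insert {z, u} E)"
proof -
  consider "u = r \<or> full E W \<rho> k u" | "u \<in> W" "\<not> full E W \<rho> k u" "\<rho> u \<noteq> r"
    | "u \<in> W" "\<not> full E W \<rho> k u" "\<rho> u = r" "\<forall>d\<in>D. \<kappa> d \<noteq> \<kappa> u"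
    | d where "u \<in> W" "\<not> full E W \<rho> k u" "\<rho> u = r" "d \<in> D" "\<kappa> d = \<kappa> u"
    using u by blast
  then show ?thesis
  proof cases
    case 1
    have "Good k n (insert {z, u} E)" using good_leaf[OF z 1] unfolding Good_def by blast
    then show ?thesis unfolding reply_def by blast
  next
    case 2
    let ?f = "{z, \<rho> u}"
    have "Good k n (insert ?f (insert {z, u} E))"
      using good_new_sibling[OF z 2(1,2), of "insert ?f (insert {z, u} E)" D] 2(3) unfolding Good_def by blast
    moreover have "?f \<in> all_edges {..<n}"
      using z parent[OF 2(1)] vertex_less[of "\<rho> u"] by (auto simp: pair_in_all_edges)
    moreover have "?f \<notin> insert {z, u} E"
      using fresh_vertex(1)[OF z(1)] parent_neq[OF 2(1)] z(1) 2(1) by (auto simp: doubleton_eq_iff)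
    ultimately show ?thesis unfolding reply_def by blast
  next
    case 3
    have "Good k n (insert {z, u} E)"
      using good_new_sibling[OF z 3(1,2), of "insert {z, u} E" "insert z D"] 3(3,4) unfolding Good_def by blast
    then show ?thesis unfolding reply_def by blast
  next
    case 4
    \<comment> \<open>The two edges are analysed in reverse order: with the root edge of
      \<open>d\<close> in place, the component of \<open>u\<close> has no vertex in \<open>D\<close>
      and can take \<open>z\<close>. The root edge may also make \<open>u\<close> full, and
      \<open>z\<close> is then a leaf below it.\<close>
    let ?E = "insert {r, d} E"
    interpret G: good k n r ?E W \<rho> h "D - {d}" \<kappa> by (rule good_root_edge[OF 4(4)])
    have "Good k n (insert {z, u} ?E)"
    proof (cases "full ?E W \<rho> k u")
      case True
      then show ?thesis using G.good_leaf[OF z, of u] unfolding Good_def by blast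
    next
      case False
      have "\<kappa> d' \<noteq> \<kappa> u" if "d' \<in> D - {d}" for d' using inj_onD[OF label_inj, of d d'] that 4(4,5) by auto
      then show ?thesis
        using G.good_new_sibling[OF z 4(1) False, of "insert {z, u} ?E" "insert z (D - {d})"] 4(3)
        unfolding Good_def by blast
    qed
    then have "Good k n (insert {r, d} (insert {z, u} E))" by (simp add: insert_commute)
    moreover have "{r, d} \<in> all_edges {..<n} - insert {z, u} E"
      using root_edge_new[OF 4(4)] z(1) 4(4) D by (auto simp: doubleton_eq_iff)
    ultimately show ?thesis unfolding reply_def by blast
  qed
qed

text \<open>Mini joins \<open>p\<close> to the root and leaves \<open>q\<close> as the vertex of
  \<open>D\<close> in the new component. This is analysed as a leaf \<open>p\<close> with a fresh
  label, to which \<open>q\<close> is attached as a sibling; \<open>p\<close> is not full because it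
  has no sibling neighbour and k - 2 \<ge> 3.\<close>

lemma isolated_step:
  assumes p: "p \<notin> insert r W" "p < n" and q: "q \<notin> insert r W" "q < n" and pq: "p \<noteq> q"
  shows "reply k n (insert {p, q} E)"
proof -
  let ?E = "insert {p, r} E" and ?W = "insert p W" and ?\<rho> = "\<rho>(p := r)"
  have "finite W" using W finite_subset by blast
  then have "finite (\<kappa> ` D)" using D finite_subset by blast
  then obtain l where l: "l \<notin> \<kappa> ` D" using ex_new_if_finite infinite_UNIV_nat by blast
  interpret G: good k n r ?E ?W ?\<rho> "h(p := Suc (h r))" D "\<kappa>(p := l)"
    using good_leaf[OF p, of r l] by blast
  have nf: "\<not> full ?E ?W ?\<rho> k p"
  proof
    assume "full ?E ?W ?\<rho> k p"
    then obtain xs where xs: "full_path ?E ?W ?\<rho> k p xs" by (auto simp: full_def)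
    have len: "1 < length xs" using full_pathD(2)[OF xs] k5 by simp
    then have "xs ! 0 = p" using full_pathD(3)[OF xs] by (cases xs) auto
    then have "sib ?E ?W ?\<rho> p (xs ! 1)" using simple_path_nth[OF full_pathD(1)[OF xs], of 0] len by simp
    then have s: "{p, xs ! 1} \<in> ?E" "xs ! 1 \<in> ?W" by (auto simp: sib_def)
    then have "xs ! 1 = r" using fresh_vertex(1)[OF p(1)] p(1) by (auto simp: doubleton_eq_iff)
    then show False using s(2) G.rW by simp
  qed
  have lab: "(\<kappa>(p := l)) d \<noteq> (\<kappa>(p := l)) p" if "d \<in> D" for d using that l p(1) D by auto
  have q': "q \<notin> insert r ?W" and pW: "p \<in> ?W" and par: "?\<rho> p = r" using q pq by auto
  have "Good k n (insert {q, p} ?E)"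
    using G.good_new_sibling[OF q' q(2) pW nf lab, of "insert {q, p} ?E" "insert q D"] par
    unfolding Good_def by blast
  moreover have "insert {q, p} ?E = insert {p, r} (insert {p, q} E)" by (simp add: insert_commute)
  moreover have "{p, r} \<in> all_edges {..<n} - insert {p, q} E"
    using p q r fresh_vertex(1)[OF p(1)] by (auto simp: pair_in_all_edges doubleton_eq_iff)
  ultimately show ?thesis unfolding reply_def by metis
qed

lemma inner_edge_cases:
  assumes "p \<in> insert r W" "q \<in> insert r W" "p \<noteq> q" "{p, q} \<notin> E" and C: "dense_family k C"
    and free: "free_of C ({..<n}, insert {p, q} E)"
  shows "p \<in> W \<and> q \<in> W \<and> \<rho> p = \<rho> q \<or> (\<exists>d\<in>D. {p, q} = {r, d})"
proof -
  have new: "a \<in> D \<and> b = r" if "a \<in> W" "\<rho> a = b" "{a, b} \<notin> E" for a b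
    using that up[of a] D_parent[of a] by blast
  consider "p \<in> W" "\<rho> p = q" | "q \<in> W" "\<rho> q = p" | "p \<in> W \<and> q \<in> W \<and> \<rho> p = \<rho> q"
    using unrelated_move_illegal[OF C assms(1-3)] free by blast
  then show ?thesis
  proof cases
    case 1
    then have "p \<in> D" "q = r" using new[OF 1] assms(4) by blast+
    then show ?thesis by (auto simp: insert_commute)
  next
    case 2
    have "{q, p} \<notin> E" using assms(4) by (simp add: insert_commute)
    then have "q \<in> D" "p = r" using new[OF 2] by blast+
    then show ?thesis by blast
  qed blast
qed

lemma step:
  assumes e: "e \<in> all_edges {..<n} - E" and C: "dense_family k C" and free: "free_of C ({..<n}, insert e E)"
  shows "reply k n (insert e E)"
proof -
  obtain p q where pq: "e = {p, q}" "p \<noteq> q" using e by (auto simp: all_edges_def card_2_iff)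
  have lt: "p < n" "q < n" using e pq by (auto simp: pair_in_all_edges)
  consider "p \<in> insert r W" "q \<in> insert r W" | "p \<notin> insert r W" "q \<in> insert r W"
    | "q \<notin> insert r W" "p \<in> insert r W" | "p \<notin> insert r W" "q \<notin> insert r W" by blast
  then show ?thesis
  proof cases
    case 1
    then consider "p \<in> W" "q \<in> W" "\<rho> p = \<rho> q" | d where "d \<in> D" "e = {r, d}"
      using inner_edge_cases[of p q C] e pq C free by blast
    then show ?thesis
    proof cases
      case 1
      then show ?thesis using sib_step pq C free by blast
    next
      case 2
      then have "Good k n (insert e E)" using good_root_edge unfolding Good_def by blast
      then show ?thesis unfolding reply_def by blast
    qed
  next
    case 2
    then show ?thesis using leaf_step lt pq by blast
  next
    case 3
    then show ?thesis using leaf_step lt pq by (metis insert_commute)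
  next
    case 4
    then show ?thesis using isolated_step lt pq by blast
  qed
qed

text \<open>Mini cannot pass. A debt is paid, or an isolated vertex is hung on the root. If there is
  neither, every remaining legal move joins siblings, and with \<open>D\<close> empty it is
  harmless.\<close>

lemma free_step:
  assumes C: "dense_family k C" and "legal_moves C n E \<noteq> {}"
  shows "\<exists>f\<in>all_edges {..<n} - E. Good k n (insert f E)"
proof (cases "D = {}")
  case False
  then obtain d where d: "d \<in> D" by blast
  have "Good k n (insert {r, d} E)" using good_root_edge[OF d] unfolding Good_def by blast
  then show ?thesis using root_edge_new[OF d] by blast
next
  case noD: True
  show ?thesis
  proof (cases "\<exists>z<n. z \<notin> insert r W")
    case True
    then obtain z where z: "z < n" "z \<notin> insert r W" by blast
    have "Good k n (insert {z, r} E)" using good_leaf[OF z(2,1), of r] unfolding Good_def by blast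
    moreover have "{z, r} \<in> all_edges {..<n} - E"
      using z r fresh_vertex(1)[OF z(2)] by (auto simp: pair_in_all_edges)
    ultimately show ?thesis by blast
  next
    case False
    obtain e where e: "e \<in> all_edges {..<n} - E" "free_of C ({..<n}, insert e E)"
      using assms(2) by (auto simp: legal_moves_def)
    obtain p q where pq: "e = {p, q}" "p \<noteq> q" using e by (auto simp: all_edges_def card_2_iff)
    have lt: "p < n" "q < n" using e pq by (auto simp: pair_in_all_edges)
    then have s: "p \<in> W" "q \<in> W" "\<rho> p = \<rho> q"
      using inner_edge_cases[of p q C] e pq C False noD by blast+
    interpret sib_move k n r E W \<rho> h D \<kappa> p q C
      using s pq e C k5 by unfold_locales (auto simp: dense_family_def)
    have "Good k n (insert {p, q} E)" using Good_no_D noD by blast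
    then show ?thesis using e(1) pq by blast
  qed
qed

end

section \<open>From the invariant to the value of the game\<close>

lemma Good_legal:
  assumes "f \<in> all_edges {..<n} - E" "Good k n (insert f E)" "dense_family k C"
  shows "f \<in> legal_moves C n E"
  using assms Good_free by (auto simp: legal_moves_def)

lemma mini_reply:
  assumes G: "Good k n E" and C: "dense_family k C" and e: "e \<in> legal_moves C n E"
    and more: "legal_moves C n (insert e E) \<noteq> {}"
  shows "\<exists>f\<in>legal_moves C n (insert e E). Good k n (insert f (insert e E))"
proof -
  obtain r W \<rho> h D \<kappa> where "good k n r E W \<rho> h D \<kappa>" using G unfolding Good_def by blast
  then have "reply k n (insert e E)" by (rule good.step[OF _ _ C]) (use e C in \<open>simp_all add: legal_moves_def\<close>)
  then have "\<exists>f\<in>all_edges {..<n} - insert e E. Good k n (insert f (insert e E))"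
    unfolding reply_def
  proof
    assume "Good k n (insert e E)"
    then obtain r W \<rho> h D \<kappa> where "good k n r (insert e E) W \<rho> h D \<kappa>" unfolding Good_def by blast
    then show ?thesis by (rule good.free_step[OF _ C more])
  qed
  then show ?thesis using Good_legal[OF _ _ C] by blast
qed

lemma finite_legal_moves: "finite (legal_moves C n E)"
  by (rule finite_subset[OF _ finite_all_edges[of "{..<n}"]]) (auto simp: legal_moves_def)

text \<open>Goodness is maintained at the positions where Max is to move. The bound is doubled to
  stay in the natural numbers; the summand 2 pays for a game that ends with a move of Max, one edge
  beyond a good position.\<close>

lemma game_value_bound:
  assumes "Good k n E" and C: "dense_family k C"
  shows "2 * game_value C n Maxi E \<le> (k - 1) * (n - 1) + 2"
  using assms(1)
proof (induction "card (all_edges {..<n} - E)" arbitrary: E rule: less_induct)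
  case less
  show ?case
  proof (cases "legal_moves C n E = {}")
    case True
    then show ?thesis using Good_card(1)[OF less.prems] by (simp add: game_value.simps[of C n Maxi E])
  next
    case False
    have mini: "2 * game_value C n Mini (insert e E) \<le> (k - 1) * (n - 1) + 2" if e: "e \<in> legal_moves C n E" for e
    proof (cases "legal_moves C n (insert e E) = {}")
      case True
      have "card (insert e E) \<le> Suc (card E)" by (rule card_insert_le_m1) auto
      then show ?thesis
        using True Good_card[OF less.prems] by (simp add: game_value.simps[of C n Mini "insert e E"])
    next
      case False
      obtain f where f: "f \<in> legal_moves C n (insert e E)" "Good k n (insert f (insert e E))"
        using mini_reply[OF less.prems C e False] by blast
      have "game_value C n Mini (insert e E) \<le> game_value C n Maxi (insert f (insert e E))"
        using False f(1) finite_legal_moves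
        by (subst game_value.simps) (auto intro!: Min_le)
      moreover have "2 * game_value C n Maxi (insert f (insert e E)) \<le> (k - 1) * (n - 1) + 2"
        using less.hyps[OF _ f(2)] legal_move_decreases[OF e] legal_move_decreases[OF f(1)] by simp
      ultimately show ?thesis by linarith
    qed
    let ?A = "(\<lambda>e. game_value C n Mini (insert e E)) ` legal_moves C n E"
    have "game_value C n Maxi E = Max ?A" using False by (simp add: game_value.simps[of C n Maxi E])
    moreover have "Max ?A \<in> ?A" using False finite_legal_moves by (intro Max_in) auto
    ultimately show ?thesis using mini by auto
  qed
qed

theorem theorem1p6:
  fixes k n :: nat and C :: "graph set"
  assumes "k \<ge> 5" and "dense_family k C" and "n \<ge> 1"
  shows "real (sat_game n C) \<le> (1 / 2) * (real k - 1) * (real n - 1) + 1"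
proof -
  have "2 * sat_game n C \<le> (k - 1) * (n - 1) + 2"
    unfolding sat_game_def using game_value_bound good_empty assms by blast
  then have "real (2 * sat_game n C) \<le> real ((k - 1) * (n - 1) + 2)" by linarith
  then show ?thesis using assms by (simp add: of_nat_diff field_simps)
qed

end
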